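(* Let $G$ be a graph. Then the following are equivalent: (a) $G$ has girth $g$ for some $g\geq 9$, $G$ is well-indumatched, and no proper subgraph of $G$ is a well-indumatched graph of girth $g$; (b) either $G=C_{11}$, or $G$ is a reduced unicyclic graph whose unique cycle $C=v_1v_2\cdots v_gv_1$ has even length $g\geq 10$, such that every rooted tree $T_{v_i}$ is of Type (i) or Type (ii), and for each $i$ (indices modulo $g$) exactly one of $T_{v_i}$ and $T_{v_{i+1}}$ is of Type (ii).
   Context: All graphs are finite, simple and undirected. An induced matching of a graph $G$ is a set $M$ of edges, no two sharing an endpoint, such that no edge of $G$ joins an endpoint of one edge of $M$ to an endpoint of another edge of $M$. A graph is well-indumatched if all of its inclusion-wise maximal induced matchings have the same size. The girth of a graph is the length of its shortest cycle. A graph is reduced if no two distinct vertices have the same set of neighbors. A unicyclic graph is a connected graph containing exactly one cycle. If $G$ is unicyclic with unique cycle $C$, then for $v\in V(C)$, $T_v$ denotes the component of $G\setminus E(C)$ containing $v$, viewed as a tree rooted at $v$. A rooted tree with root $v$ is of Type (i) if it consists of the single vertex $v$, and of Type (ii) if it is a path with two edges having $v$ as one of its end vertices. $C_n$ denotes the cycle on $n$ vertices. *)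

theory Defs
  imports Main "HOL-Library.Extended_Nat"
begin

text \<open>Undirected graphs: an edge is the two-element set of its endpoints.\<close>

record 'a ugraph =
  verts :: "'a set"
  edges :: "'a set set"

definition simple_graph :: "'a ugraph \<Rightarrow> bool" where
  "simple_graph G \<longleftrightarrow> finite (verts G) \<and> (\<forall>e\<in>edges G. e \<subseteq> verts G \<and> card e = 2)"

definition subgraph :: "'a ugraph \<Rightarrow> 'a ugraph \<Rightarrow> bool" where
  "subgraph H G \<longleftrightarrow> simple_graph H \<and> verts H \<subseteq> verts G \<and> edges H \<subseteq> edges G"

definition proper_subgraph :: "'a ugraph \<Rightarrow> 'a ugraph \<Rightarrow> bool" where
  "proper_subgraph H G \<longleftrightarrow> subgraph H G \<and> H \<noteq> G"

definition isomorphic :: "'a ugraph \<Rightarrow> 'b ugraph \<Rightarrow> bool" where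
  "isomorphic G H \<longleftrightarrow>
    (\<exists>f. bij_betw f (verts G) (verts H) \<and>
      (\<forall>u\<in>verts G. \<forall>v\<in>verts G. {u, v} \<in> edges G \<longleftrightarrow> {f u, f v} \<in> edges H))"

definition nbhd :: "'a ugraph \<Rightarrow> 'a \<Rightarrow> 'a set" where
  "nbhd G v = {u. {v, u} \<in> edges G}"

definition reduced :: "'a ugraph \<Rightarrow> bool" where
  "reduced G \<longleftrightarrow> (\<forall>u\<in>verts G. \<forall>v\<in>verts G. u \<noteq> v \<longrightarrow> nbhd G u \<noteq> nbhd G v)"

definition induced_matching :: "'a ugraph \<Rightarrow> 'a set set \<Rightarrow> bool" where
  "induced_matching G M \<longleftrightarrow> M \<subseteq> edges G \<and>
    (\<forall>e\<in>M. \<forall>f\<in>M. e \<noteq> f \<longrightarrow> e \<inter> f = {} \<and> (\<forall>x\<in>e. \<forall>y\<in>f. {x, y} \<notin> edges G))"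

definition maximal_induced_matching :: "'a ugraph \<Rightarrow> 'a set set \<Rightarrow> bool" where
  "maximal_induced_matching G M \<longleftrightarrow> induced_matching G M \<and>
    (\<forall>N. induced_matching G N \<and> M \<subseteq> N \<longrightarrow> N = M)"

definition well_indumatched :: "'a ugraph \<Rightarrow> bool" where
  "well_indumatched G \<longleftrightarrow>
    (\<forall>M N. maximal_induced_matching G M \<and> maximal_induced_matching G N \<longrightarrow> card M = card N)"

text \<open>The cycle running through the vertices of \<open>vs\<close> in this order and back to the first one.\<close>

definition cycle_of :: "'a list \<Rightarrow> 'a ugraph" where
  "cycle_of vs = \<lparr>verts = set vs,
     edges = {{vs ! i, vs ! (Suc i mod length vs)} |i. i < length vs}\<rparr>"

definition cycle_graph :: "nat \<Rightarrow> nat ugraph" where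
  "cycle_graph n = cycle_of [0..<n]"

definition is_cycle :: "'a ugraph \<Rightarrow> bool" where
  "is_cycle H \<longleftrightarrow> (\<exists>vs. distinct vs \<and> length vs \<ge> 3 \<and> H = cycle_of vs)"

text \<open>Cycles are counted as subgraphs, so rotations and reversals of the vertex list are identified.\<close>

definition cycles :: "'a ugraph \<Rightarrow> 'a ugraph set" where
  "cycles G = {H. is_cycle H \<and> subgraph H G}"

text \<open>The girth of an acyclic graph is \<open>\<infinity>\<close>.\<close>

definition girth :: "'a ugraph \<Rightarrow> enat" where
  "girth G = (INF H\<in>cycles G. enat (card (edges H)))"

definition reachable :: "'a ugraph \<Rightarrow> 'a \<Rightarrow> 'a \<Rightarrow> bool" where
  "reachable G u v \<longleftrightarrow> (u, v) \<in> {(x, y). {x, y} \<in> edges G}\<^sup>*"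

definition connected_graph :: "'a ugraph \<Rightarrow> bool" where
  "connected_graph G \<longleftrightarrow> verts G \<noteq> {} \<and> (\<forall>u\<in>verts G. \<forall>v\<in>verts G. reachable G u v)"

definition component :: "'a ugraph \<Rightarrow> 'a \<Rightarrow> 'a ugraph" where
  "component G v = \<lparr>verts = {u\<in>verts G. reachable G v u},
     edges = {e\<in>edges G. \<forall>u\<in>e. reachable G v u}\<rparr>"

definition unicyclic :: "'a ugraph \<Rightarrow> bool" where
  "unicyclic G \<longleftrightarrow> connected_graph G \<and> (\<exists>!H. H \<in> cycles G)"

definition unique_cycle :: "'a ugraph \<Rightarrow> 'a ugraph" where
  "unique_cycle G = (THE H. H \<in> cycles G)"

definition delete_edges :: "'a ugraph \<Rightarrow> 'a set set \<Rightarrow> 'a ugraph" where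
  "delete_edges G F = \<lparr>verts = verts G, edges = edges G - F\<rparr>"

definition cycle_tree :: "'a ugraph \<Rightarrow> 'a \<Rightarrow> 'a ugraph" where
  "cycle_tree G v = component (delete_edges G (edges (unique_cycle G))) v"

text \<open>In \<open>type_i\<close> and \<open>type_ii\<close> the second argument is the root of the tree.\<close>

definition type_i :: "'a ugraph \<Rightarrow> 'a \<Rightarrow> bool" where
  "type_i T v \<longleftrightarrow> T = \<lparr>verts = {v}, edges = {}\<rparr>"

definition type_ii :: "'a ugraph \<Rightarrow> 'a \<Rightarrow> bool" where
  "type_ii T v \<longleftrightarrow>
    (\<exists>a b. distinct [v, a, b] \<and> T = \<lparr>verts = {v, a, b}, edges = {{v, a}, {a, b}}\<rparr>)"

end

theory Submission
  imports Defs
begin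

text \<open>In a cycle with tails of length two at every other vertex, the edges meeting a tail
  (or its foot) form one clique of conflicting edges per tail, and the outermost edge of the tail
  conflicts with nothing else; hence every maximal induced matching picks exactly one edge per tail.

  Conversely, let \<open>C\<close> be a shortest cycle, of length \<open>g \<ge> 9\<close>, of a well-indumatched graph. Deleting the
  closed neighbourhood of an induced matching preserves well-indumatchedness, so one may assume
  that \<open>C\<close> carries only pendant trees of depth at most two. An exchange argument (replacing some
  edges of a matching by more edges, without creating new conflicts) shows that two consecutive
  vertices of \<open>C\<close> cannot both have a tail of length two, and that such a tail at \<open>v\<^sub>i\<close> forces one at
  \<open>v\<^sub>i\<^sub>+\<^sub>2\<close>; if there is no such tail at all, then exchanges along the cycle leave only \<open>g = 11\<close>. So for
  \<open>g \<noteq> 11\<close> the length is even and the graph contains a cycle with alternating tails; it has \<open>2g\<close>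
  edges, and minimality follows by counting.\<close>

section \<open>Induced matchings\<close>

text \<open>The matching being altered is an arbitrary maximal extension, so an exchange has to be
  safe against every edge that it might contain. Hence the trimming to edges near the cycle, and
  hence the edges that an exchange merely keeps: they block the dangerous ones. Without tails,
  safety becomes a covering of index intervals: a cycle edge starting at \<open>i\<close> blocks the
  vertices \<open>i - 1\<close> to \<open>i + 2\<close>, and a vertex without pendant edge is
  blocked once both its cycle neighbours are. The bound 9 excludes connections between distinct
  cycle vertices through one, two or three outer vertices: each of the two arcs closes such a detour
  to a cycle, and the arcs have total length \<open>g\<close>, so \<open>2 * g \<le> g + 8\<close>.
  The exception 11 is the only n from 9 on with ceiling(n / 5) = floor(n / 3). In C_n an edge
  conflicts with five edges, itself included, and chosen edges start at least three apart, so these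
  two numbers bound the size of a maximal induced matching.\<close>

definition apart :: "'a ugraph \<Rightarrow> 'a set \<Rightarrow> 'a set \<Rightarrow> bool" where
  "apart G e f \<longleftrightarrow> (\<forall>x\<in>e. \<forall>y\<in>f. x \<noteq> y \<and> {x, y} \<notin> edges G)"

lemma apart_sym: "apart G e f \<Longrightarrow> apart G f e"
  by (force simp: apart_def insert_commute)

lemma edge_cases:
  assumes "simple_graph G" "e \<in> edges G"
  obtains x y where "e = {x, y}" "x \<noteq> y" "x \<in> verts G" "y \<in> verts G"
  using assms unfolding simple_graph_def by (metis card_2_iff insert_subset)

lemma edge_other_end:
  assumes "simple_graph G" "e \<in> edges G" "x \<in> e"
  obtains y where "e = {x, y}" "x \<noteq> y"
proof -
  obtain a b where "e = {a, b}" "a \<noteq> b" using assms(1,2) by (rule edge_cases)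
  then show thesis using assms(3) that[of a] that[of b] by (auto simp: insert_commute)
qed

lemma edge_neq: "simple_graph G \<Longrightarrow> {x, y} \<in> edges G \<Longrightarrow> x \<noteq> y"
  by (auto simp: simple_graph_def)

lemma edge_verts: "simple_graph G \<Longrightarrow> {x, y} \<in> edges G \<Longrightarrow> x \<in> verts G \<and> y \<in> verts G"
  by (auto simp: simple_graph_def)

lemma finite_edges: "simple_graph G \<Longrightarrow> finite (edges G)"
  unfolding simple_graph_def by (meson Pow_iff finite_Pow_iff finite_subset subsetI)

lemma not_apart_self: "simple_graph G \<Longrightarrow> e \<in> edges G \<Longrightarrow> \<not> apart G e e"
  by (erule (1) edge_cases) (auto simp: apart_def)

lemma induced_matching_iff:
  "induced_matching G M \<longleftrightarrow> M \<subseteq> edges G \<and> (\<forall>e\<in>M. \<forall>f\<in>M. e \<noteq> f \<longrightarrow> apart G e f)"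
  unfolding induced_matching_def apart_def by blast

lemma induced_matching_Un:
  assumes "induced_matching G M" "induced_matching G N"
    and "\<And>e f. e \<in> M \<Longrightarrow> f \<in> N \<Longrightarrow> apart G e f"
  shows "induced_matching G (M \<union> N)"
  unfolding induced_matching_iff
proof (intro conjI ballI impI)
  show "M \<union> N \<subseteq> edges G" using assms by (simp add: induced_matching_iff)
  fix e f assume "e \<in> M \<union> N" "f \<in> M \<union> N" "e \<noteq> f"
  then show "apart G e f"
    using assms apart_sym[OF assms(3), of f e] unfolding induced_matching_iff by (elim UnE) simp_all
qed

lemma extend_to_maximal:
  assumes "simple_graph G" "induced_matching G M"
  obtains N where "maximal_induced_matching G N" "M \<subseteq> N"
proof -
  let ?S = "{N. induced_matching G N \<and> M \<subseteq> N}"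
  have "finite ?S"
    by (rule finite_subset[of _ "Pow (edges G)"])
      (auto simp: induced_matching_iff finite_edges assms)
  moreover have "M \<in> ?S" using assms by auto
  ultimately obtain N where "N \<in> ?S" "\<forall>N'\<in>?S. N \<subseteq> N' \<longrightarrow> N = N'"
    using finite_has_maximal2[of ?S M] by auto
  then show thesis
    by (intro that[of N]) (auto simp: maximal_induced_matching_def)
qed

lemma maximal_induced_matching_blocks:
  assumes "maximal_induced_matching G M" "f \<in> edges G" "f \<notin> M"
  shows "\<exists>e\<in>M. \<not> apart G f e"
proof (rule ccontr)
  assume "\<not> ?thesis"
  then have "induced_matching G (insert f M)"
    using assms by (auto simp: maximal_induced_matching_def induced_matching_iff dest: apart_sym)
  then show False
    using assms unfolding maximal_induced_matching_def by blast
qed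

text \<open>No edge is apart from itself, so repetitions are impossible. This lets explicit
  matchings be written as lists and compared by length.\<close>

lemma distinct_if_apart:
  assumes "simple_graph G" "set es \<subseteq> edges G" "sorted_wrt (apart G) es"
  shows "distinct es"
  using assms(2,3)
  by (induction es) (use not_apart_self[OF assms(1)] in auto)

lemma apart_if_sorted_wrt:
  assumes "sorted_wrt (apart G) es" "e \<in> set es" "f \<in> set es" "e \<noteq> f"
  shows "apart G e f"
  using assms by (induction es) (auto dest: apart_sym)

text \<open>Extend \<open>qs @ es\<close> to a maximal induced matching and trade \<open>es\<close>
  for \<open>ds\<close>: by \<open>dom\<close> no further edge of it conflicts with
  \<open>ds\<close>, so a larger induced matching results. The edges \<open>qs\<close> stay in both
  matchings; their presence keeps out edges that would conflict with \<open>ds\<close>. The lists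
  \<open>es\<close> and \<open>ds\<close> may overlap.\<close>

lemma well_indumatched_exchange:
  assumes simple: "simple_graph G" and wim: "well_indumatched G"
    and E: "set (qs @ es @ ds) \<subseteq> edges G"
    and apart_es: "sorted_wrt (apart G) (qs @ es)" and apart_ds: "sorted_wrt (apart G) (qs @ ds)"
    and len: "length es < length ds"
    and dom: "\<And>f d. f \<in> edges G \<Longrightarrow> (\<And>e. e \<in> set (qs @ es) \<Longrightarrow> apart G f e) \<Longrightarrow>
      d \<in> set ds \<Longrightarrow> apart G f d"
  shows False
proof -
  have "induced_matching G (set (qs @ es))"
    using E apart_if_sorted_wrt[OF apart_es] by (auto simp: induced_matching_iff)
  then obtain M where M: "maximal_induced_matching G M" "set (qs @ es) \<subseteq> M"
    by (rule extend_to_maximal[OF simple])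
  have indM: "induced_matching G M" using M(1) by (simp add: maximal_induced_matching_def)
  have finM: "finite M"
    using indM finite_edges[OF simple] by (auto simp: induced_matching_iff intro: finite_subset)
  have d_es: "distinct (qs @ es)" and d_ds: "distinct (qs @ ds)"
    using E distinct_if_apart[OF simple _ apart_es] distinct_if_apart[OF simple _ apart_ds]
    by auto
  have cross: "apart G f d" if "f \<in> M - set es" "d \<in> set ds" for f d
  proof (cases "f \<in> set qs")
    case True
    then show ?thesis using apart_ds that by (auto simp: sorted_wrt_append)
  next
    case False
    have "apart G f e" if "e \<in> set (qs @ es)" for e
    proof -
      have "f \<noteq> e" using that False \<open>f \<in> M - set es\<close> by auto
      then show ?thesis using that M(2) \<open>f \<in> M - set es\<close> indM unfolding induced_matching_iff by blast
    qed
    moreover have "f \<in> edges G" using that indM by (auto simp: induced_matching_iff)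
    ultimately show ?thesis using dom that by blast
  qed
  let ?M = "(M - set es) \<union> set ds"
  have "apart G d d'" if "d \<in> set ds" "d' \<in> set ds" "d \<noteq> d'" for d d'
    using apart_if_sorted_wrt[OF apart_ds] that by auto
  then have "induced_matching G (set ds)"
    using E by (simp add: induced_matching_iff)
  moreover have "induced_matching G (M - set es)"
    using indM unfolding induced_matching_iff by blast
  ultimately have "induced_matching G ?M"
    using induced_matching_Un cross by blast
  then obtain M' where M': "maximal_induced_matching G M'" "?M \<subseteq> M'"
    by (rule extend_to_maximal[OF simple])
  then have "finite M'"
    using finite_edges[OF simple]
    by (auto simp: maximal_induced_matching_def induced_matching_iff intro: finite_subset)
  have "f \<notin> set ds" if "f \<in> M - set es" for f
    using cross[OF that, of f] not_apart_self[OF simple, of f] E by auto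
  then have "(M - set es) \<inter> set ds = {}" by blast
  then have "card ?M = card M - length es + length ds"
    using finM M(2) d_es d_ds by (simp add: card_Un_disjoint card_Diff_subset distinct_card)
  moreover have "length es \<le> card M"
    using M(2) finM d_es by (metis card_mono distinct_append distinct_card le_sup_iff set_append)
  ultimately have "card M < card ?M" using len by linarith
  also have "\<dots> \<le> card M'" using M'(2) \<open>finite M'\<close> by (rule card_mono[rotated])
  finally have "card M \<noteq> card M'" by simp
  then show False using wim M(1) M'(1) unfolding well_indumatched_def by blast
qed

section \<open>Deleting the closed neighbourhood of an induced matching\<close>

text \<open>With a singleton, \<open>apart G {u} e\<close> says that \<open>u\<close> lies outside
  the closed neighbourhood of \<open>e\<close>; so this is an induced subgraph, and conflicts
  between surviving edges are those of \<open>G\<close>.\<close>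

definition remaining :: "'a ugraph \<Rightarrow> 'a set set \<Rightarrow> 'a ugraph" where
  "remaining G N = (let U = {u \<in> verts G. \<forall>e\<in>N. apart G {u} e} in
     \<lparr>verts = U, edges = {e \<in> edges G. e \<subseteq> U}\<rparr>)"

lemma edges_remaining:
  assumes "simple_graph G"
  shows "edges (remaining G N) = {e \<in> edges G. \<forall>f\<in>N. apart G e f}"
proof (intro equalityI subsetI)
  fix e assume "e \<in> {e \<in> edges G. \<forall>f\<in>N. apart G e f}"
  then show "e \<in> edges (remaining G N)"
    using assms by (fastforce simp: remaining_def Let_def apart_def simple_graph_def)
qed (fastforce simp: remaining_def Let_def apart_def)

lemma simple_remaining: "simple_graph G \<Longrightarrow> simple_graph (remaining G N)"
  by (auto simp: remaining_def Let_def simple_graph_def)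

lemma apart_remaining:
  assumes "e \<in> edges (remaining G N)" "f \<in> edges (remaining G N)"
  shows "apart (remaining G N) e f \<longleftrightarrow> apart G e f"
proof -
  have "{x, y} \<in> edges (remaining G N) \<longleftrightarrow> {x, y} \<in> edges G" if "x \<in> e" "y \<in> f" for x y
    using assms that by (auto simp: remaining_def Let_def)
  then show ?thesis unfolding apart_def by blast
qed

text \<open>Adding \<open>N\<close> turns a maximal induced matching of the remaining graph into one
  of \<open>G\<close>: an edge apart from all of \<open>N\<close> survives the deletion and is
  blocked there. Sizes shift by the constant \<open>card N\<close>.\<close>

lemma well_indumatched_remaining:
  assumes simple: "simple_graph G" and wim: "well_indumatched G" and N: "induced_matching G N"
  shows "well_indumatched (remaining G N)"
proof -
  let ?H = "remaining G N"
  have fin: "finite A" if "A \<subseteq> edges G" for A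
    using that finite_edges[OF simple] by (rule finite_subset)
  have extend: "maximal_induced_matching G (M \<union> N) \<and> card (M \<union> N) = card M + card N"
    if M: "maximal_induced_matching ?H M" for M
  proof
    have indM: "induced_matching ?H M" using M by (simp add: maximal_induced_matching_def)
    then have M_sub: "M \<subseteq> edges ?H" by (simp add: induced_matching_iff)
    then have M_N: "\<And>e f. e \<in> M \<Longrightarrow> f \<in> N \<Longrightarrow> apart G e f" and M_G: "M \<subseteq> edges G"
      by (auto simp: edges_remaining[OF simple])
    have "apart G e f" if "e \<in> M" "f \<in> M" "e \<noteq> f" for e f
      using indM M_sub that apart_remaining[of e G N f] unfolding induced_matching_iff by blast
    then have ind: "induced_matching G (M \<union> N)"
      using N M_N M_G by (intro induced_matching_Un) (simp_all add: induced_matching_iff)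
    moreover have "N' \<subseteq> M \<union> N" if N': "induced_matching G N'" "M \<union> N \<subseteq> N'" for N'
    proof
      fix f assume f: "f \<in> N'"
      show "f \<in> M \<union> N"
      proof (rule ccontr)
        assume f_new: "f \<notin> M \<union> N"
        have apart_f: "apart G f e" if "e \<in> M \<union> N" for e
        proof -
          have "e \<in> N'" "e \<noteq> f" using that f_new N'(2) by auto
          then show ?thesis using N'(1) f by (simp add: induced_matching_iff)
        qed
        then have "f \<in> edges ?H"
          using f N' by (auto simp: edges_remaining[OF simple] induced_matching_iff)
        then show False
          using maximal_induced_matching_blocks[OF M] f_new apart_f M_sub
          by (meson UnCI apart_remaining subsetD)
      qed
    qed
    ultimately show "maximal_induced_matching G (M \<union> N)"
      unfolding maximal_induced_matching_def by blast
    have "M \<inter> N = {}" using M_N M_G not_apart_self[OF simple] by blast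
    then show "card (M \<union> N) = card M + card N"
      using M_G N fin by (simp add: card_Un_disjoint induced_matching_iff)
  qed
  show ?thesis
    unfolding well_indumatched_def
  proof (intro allI impI)
    fix M M' assume "maximal_induced_matching ?H M \<and> maximal_induced_matching ?H M'"
    then show "card M = card M'"
      using extend wim unfolding well_indumatched_def by (metis add_right_cancel)
  qed
qed

section \<open>Cycles and girth\<close>

text \<open>The vertices of a cycle are indexed by all integers, periodically.\<close>

definition cyc :: "'a list \<Rightarrow> int \<Rightarrow> 'a" where
  "cyc vs i = vs ! nat (i mod int (length vs))"

lemma cyc_int: "i < length vs \<Longrightarrow> cyc vs (int i) = vs ! i"
  by (simp add: cyc_def)

lemma cyc_Suc: "0 < length vs \<Longrightarrow> cyc vs (int i + 1) = vs ! (Suc i mod length vs)"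
  by (simp add: cyc_def nat_mod_distrib nat_add_distrib)

lemma cyc_eq_iff:
  assumes "distinct vs" "vs \<noteq> []"
  shows "cyc vs i = cyc vs j \<longleftrightarrow> int (length vs) dvd i - j"
proof -
  have "nat (k mod int (length vs)) < length vs" for k
    using assms(2) by (simp add: nat_less_iff)
  then have "cyc vs i = cyc vs j \<longleftrightarrow> nat (i mod int (length vs)) = nat (j mod int (length vs))"
    using assms by (simp add: cyc_def nth_eq_iff_index_eq)
  also have "\<dots> \<longleftrightarrow> i mod int (length vs) = j mod int (length vs)"
    using assms(2) by (auto simp: nat_eq_iff)
  finally show ?thesis by (simp add: mod_eq_dvd_iff)
qed

lemma cyc_index:
  assumes "vs \<noteq> []"
  obtains k where "k < length vs" "cyc vs i = vs ! k" "cyc vs (i + 1) = vs ! (Suc k mod length vs)"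
    "int (length vs) dvd i - int k"
proof
  let ?k = "nat (i mod int (length vs))"
  show "?k < length vs" using assms by (simp add: nat_less_iff)
  show "cyc vs i = vs ! ?k" by (simp add: cyc_def)
  have "int (Suc ?k mod length vs) = (i + 1) mod int (length vs)"
    using assms by (simp add: zmod_int mod_simps add.commute)
  then show "cyc vs (i + 1) = vs ! (Suc ?k mod length vs)"
    by (simp add: cyc_def) (metis nat_int)
  show "int (length vs) dvd i - int ?k"
    using assms by simp
qed

lemma range_cyc: "vs \<noteq> [] \<Longrightarrow> range (cyc vs) = set vs"
  by (auto simp: in_set_conv_nth) (metis cyc_index, metis cyc_int rangeI)

lemma in_set_cyc:
  assumes "x \<in> set vs"
  obtains i where "x = cyc vs i"
  using assms cyc_int by (metis in_set_conv_nth)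

lemma edges_cycle_of:
  assumes "vs \<noteq> []"
  shows "edges (cycle_of vs) = {{cyc vs i, cyc vs (i + 1)} |i. True}"
proof (intro equalityI subsetI)
  fix e assume "e \<in> edges (cycle_of vs)"
  then obtain i where "i < length vs" "e = {vs ! i, vs ! (Suc i mod length vs)}"
    by (auto simp: cycle_of_def)
  then show "e \<in> {{cyc vs i, cyc vs (i + 1)} |i. True}"
    using assms by (auto intro!: exI[of _ "int i"] simp: cyc_int cyc_Suc)
next
  fix e assume "e \<in> {{cyc vs i, cyc vs (i + 1)} |i. True}"
  then obtain i where e: "e = {cyc vs i, cyc vs (i + 1)}" by auto
  obtain k where "k < length vs" "cyc vs i = vs ! k" "cyc vs (i + 1) = vs ! (Suc k mod length vs)"
    using cyc_index[OF assms, of i] by metis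
  with e show "e \<in> edges (cycle_of vs)" by (auto simp: cycle_of_def)
qed

lemma verts_cycle_of [simp]: "verts (cycle_of vs) = set vs"
  by (simp add: cycle_of_def)

lemma cyc_edge: "vs \<noteq> [] \<Longrightarrow> {cyc vs i, cyc vs (i + 1)} \<in> edges (cycle_of vs)"
  by (auto simp: edges_cycle_of)

lemma not_dvd_small: "k \<noteq> 0 \<Longrightarrow> \<bar>k\<bar> < g \<Longrightarrow> \<not> g dvd k" for g k :: int
  using zdvd_not_zless[of "\<bar>k\<bar>" g] by auto

lemma cyc_adjacent:
  assumes "distinct vs" "vs \<noteq> []" "{cyc vs i, x} \<in> edges (cycle_of vs)"
  shows "x = cyc vs (i + 1) \<or> x = cyc vs (i - 1)"
proof -
  obtain j where "{cyc vs i, x} = {cyc vs j, cyc vs (j + 1)}"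
    using assms by (auto simp: edges_cycle_of)
  then consider "cyc vs i = cyc vs j" "x = cyc vs (j + 1)"
    | "cyc vs i = cyc vs (j + 1)" "x = cyc vs j"
    by (auto simp: doubleton_eq_iff)
  then show ?thesis
    using assms(1,2) by cases (auto simp: cyc_eq_iff dvd_diff_commute algebra_simps)
qed

lemma simple_cycle_of:
  assumes "distinct vs" "3 \<le> length vs"
  shows "simple_graph (cycle_of vs)"
proof -
  have ne: "vs \<noteq> []" using assms by auto
  have "cyc vs i \<noteq> cyc vs (i + 1)" for i
    using assms ne not_dvd_small[of "-1" "int (length vs)"] by (simp add: cyc_eq_iff)
  then show ?thesis
    using range_cyc[OF ne] by (auto simp: simple_graph_def edges_cycle_of[OF ne])
qed

lemma card_edges_cycle_of:
  assumes "distinct vs" "3 \<le> length vs"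
  shows "card (edges (cycle_of vs)) = length vs"
proof -
  have ne: "vs \<noteq> []" using assms by auto
  let ?e = "\<lambda>i. {vs ! i, vs ! (Suc i mod length vs)}"
  have "inj_on ?e {..<length vs}"
  proof
    fix i j assume "i \<in> {..<length vs}" "j \<in> {..<length vs}" and eq: "?e i = ?e j"
    then have ij: "i < length vs" "j < length vs" by auto
    have "{cyc vs (int i), cyc vs (int i + 1)} = {cyc vs (int j), cyc vs (int j + 1)}"
      using eq ij ne by (simp add: cyc_int cyc_Suc)
    then consider "cyc vs (int i) = cyc vs (int j)"
      | "cyc vs (int i) = cyc vs (int j + 1)" "cyc vs (int i + 1) = cyc vs (int j)"
      by (auto simp: doubleton_eq_iff)
    then show "i = j"
    proof cases
      case 1
      then show ?thesis using ij assms by (simp add: cyc_int nth_eq_iff_index_eq)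
    next
      case 2
      \<comment> \<open>Two equal edges with swapped ends would make the length divide 2.\<close>
      then have "int (length vs) dvd (int i + 1 - int j) - (int i - (int j + 1))"
        using assms ne by (metis cyc_eq_iff dvd_diff)
      then show ?thesis using not_dvd_small[of 2 "int (length vs)"] assms by simp
    qed
  qed
  moreover have "edges (cycle_of vs) = ?e ` {..<length vs}"
    by (auto simp: cycle_of_def)
  ultimately show ?thesis by (simp add: card_image)
qed

text \<open>A vertex has only two neighbours on a cycle. So at each vertex of \<open>ws\<close> both
  of its \<open>vs\<close>-neighbours are already used by \<open>ws\<close>, and following
  successors leads through all of \<open>vs\<close>.\<close>

lemma cycle_of_subgraph_cycle_of:
  assumes vs: "distinct vs" "3 \<le> length vs" and ws: "distinct ws" "3 \<le> length ws"
    and sub: "edges (cycle_of ws) \<subseteq> edges (cycle_of vs)"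
  shows "cycle_of ws = cycle_of vs"
proof -
  have ne: "vs \<noteq> []" "ws \<noteq> []" using assms by auto
  have verts_Union: "set us = \<Union> (edges (cycle_of us))" if "us \<noteq> []" for us :: "'a list"
  proof -
    have "range (cyc us) = \<Union> (edges (cycle_of us))"
      by (simp add: edges_cycle_of[OF that]) blast
    then show ?thesis using range_cyc[OF that] by simp
  qed
  have step: "{cyc vs i, cyc vs (i + 1)} \<in> edges (cycle_of ws)" if i: "cyc vs i \<in> set ws" for i
  proof -
    obtain j where j: "cyc vs i = cyc ws j" using i by (rule in_set_cyc)
    have e: "{cyc vs i, cyc ws (j + 1)} \<in> edges (cycle_of ws)"
      "{cyc vs i, cyc ws (j - 1)} \<in> edges (cycle_of ws)"
      using cyc_edge[OF ne(2), of j] cyc_edge[OF ne(2), of "j - 1"] by (auto simp: j insert_commute)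
    then have "cyc ws (j + 1) \<in> {cyc vs (i + 1), cyc vs (i - 1)}"
      "cyc ws (j - 1) \<in> {cyc vs (i + 1), cyc vs (i - 1)}"
      using cyc_adjacent[OF vs(1) ne(1)] sub by blast+
    moreover have "cyc ws (j + 1) \<noteq> cyc ws (j - 1)"
      using ws ne not_dvd_small[of 2 "int (length ws)"] by (simp add: cyc_eq_iff)
    ultimately show ?thesis using e by auto
  qed
  have "set ws \<subseteq> set vs"
    using sub verts_Union ne by (metis Union_mono)
  moreover have "cyc ws 0 \<in> set ws" using range_cyc[OF ne(2)] by blast
  ultimately obtain i0 where i0: "cyc vs i0 \<in> set ws"
    using range_cyc[OF ne(1)] by (metis rangeE subsetD)
  have up: "cyc vs (i0 + int n) \<in> set ws" for n
  proof (induction n)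
    case (Suc n)
    then show ?case
      using step[of "i0 + int n"] verts_Union[OF ne(2)] by (auto simp: algebra_simps)
  qed (use i0 in simp)
  have "cyc vs i \<in> set ws" for i
  proof -
    let ?n = "nat ((i - i0) mod int (length vs))"
    have "int (length vs) dvd i0 + int ?n - i"
      using ne by (simp add: mod_eq_dvd_iff[symmetric] mod_simps)
    then have "cyc vs (i0 + int ?n) = cyc vs i"
      using vs ne by (simp add: cyc_eq_iff)
    then show ?thesis using up by metis
  qed
  then have "edges (cycle_of vs) \<subseteq> edges (cycle_of ws)"
    using step by (auto simp: edges_cycle_of[OF ne(1)])
  then have "edges (cycle_of ws) = edges (cycle_of vs)" using sub by simp
  then have "set ws = set vs" using verts_Union ne by metis
  with \<open>edges (cycle_of ws) = edges (cycle_of vs)\<close> show ?thesis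
    by (simp add: cycle_of_def)
qed

lemma cycles_cycle_of:
  assumes "distinct vs" "3 \<le> length vs"
  shows "cycles (cycle_of vs) = {cycle_of vs}"
  using cycle_of_subgraph_cycle_of[OF assms] simple_cycle_of[OF assms] assms
  by (auto simp: cycles_def is_cycle_def subgraph_def)

section \<open>Girth and short closed walks\<close>

lemma subgraph_trans: "subgraph H K \<Longrightarrow> subgraph K G \<Longrightarrow> subgraph H G"
  by (auto simp: subgraph_def)

lemma girth_le: "girth G = enat g \<Longrightarrow> H \<in> cycles G \<Longrightarrow> g \<le> card (edges H)"
  by (metis INF_lower enat_ord_simps(1) girth_def)

text \<open>The infimum is attained because \<open>enat\<close> is well-ordered; finiteness excludes
  the empty infimum, which is \<infinity>.\<close>

lemma girth_cycle:
  assumes "girth G = enat g"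
  obtains vs where "distinct vs" "length vs = g" "3 \<le> g" "cycle_of vs \<in> cycles G"
proof -
  have "cycles G \<noteq> {}" using assms by (auto simp: girth_def top_enat_def)
  then have "girth G \<in> (\<lambda>H. enat (card (edges H))) ` cycles G"
    unfolding girth_def by (metis wellorder_InfI all_not_in_conv image_is_empty)
  then obtain H where H: "H \<in> cycles G" "card (edges H) = g" using assms by auto
  then obtain vs where "distinct vs" "3 \<le> length vs" "H = cycle_of vs"
    by (auto simp: cycles_def is_cycle_def)
  then show thesis using H that by (auto simp: card_edges_cycle_of)
qed

text \<open>Repeating the head at the end makes \<open>successively\<close> include the closing
  edge, so that short cycles given by explicit lists can be checked by simplification.\<close>

lemma closed_walk_girth:
  assumes simple: "simple_graph G" and girth: "girth G = enat g"
    and vs: "distinct vs" "3 \<le> length vs"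
    and walk: "successively (\<lambda>x y. {x, y} \<in> edges G) (vs @ [hd vs])"
  shows "g \<le> length vs"
proof -
  have ne: "vs \<noteq> []" using vs by auto
  have "{vs ! i, vs ! (Suc i mod length vs)} \<in> edges G" if "i < length vs" for i
  proof -
    have "{(vs @ [hd vs]) ! i, (vs @ [hd vs]) ! Suc i} \<in> edges G"
      using walk that by (simp add: successively_conv_nth)
    moreover have "(vs @ [hd vs]) ! Suc i = vs ! (Suc i mod length vs)"
      using that ne by (cases "Suc i = length vs") (auto simp: nth_append hd_conv_nth)
    ultimately show ?thesis using that by (simp add: nth_append)
  qed
  then have "edges (cycle_of vs) \<subseteq> edges G" by (auto simp: cycle_of_def)
  moreover have "set vs \<subseteq> verts G"
  proof
    fix x assume "x \<in> set vs"
    then obtain i where "x = cyc vs i" by (rule in_set_cyc)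
    then have "{x, cyc vs (i + 1)} \<in> edges G"
      using \<open>edges (cycle_of vs) \<subseteq> edges G\<close> cyc_edge[OF ne] by blast
    then show "x \<in> verts G" using simple by (simp add: edge_verts)
  qed
  ultimately have "cycle_of vs \<in> cycles G"
    using vs simple_cycle_of[OF vs] by (auto simp: cycles_def is_cycle_def subgraph_def)
  then show ?thesis using girth_le[OF girth] card_edges_cycle_of[OF vs] by fastforce
qed

section \<open>A cycle with pendant trees of depth at most two\<close>

text \<open>The assumptions \<open>chord\<close>, \<open>foot\<close>, \<open>no_edge\<close> and
  \<open>no_cherry\<close> restrict connections to the cycle through 0, 1, 2 and 3 outer vertices,
  including those returning to the same cycle vertex. Only these consequences of large girth enter
  the exchanges.\<close>

locale hairy_cycle =
  fixes G :: "'a ugraph" and v :: "int \<Rightarrow> 'a" and g :: int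
  assumes simple: "simple_graph G" and wim: "well_indumatched G" and g9: "9 \<le> g"
    and v_eq: "v i = v j \<longleftrightarrow> g dvd i - j"
    and ring: "{v i, v (i + 1)} \<in> edges G"
    and chord: "{v i, v j} \<in> edges G \<Longrightarrow> v j = v (i + 1) \<or> v j = v (i - 1)"
    and foot: "x \<notin> range v \<Longrightarrow> {v i, x} \<in> edges G \<Longrightarrow> {v j, x} \<in> edges G \<Longrightarrow> v i = v j"
    and no_edge: "x \<notin> range v \<Longrightarrow> y \<notin> range v \<Longrightarrow> {v i, x} \<in> edges G \<Longrightarrow> {v j, y} \<in> edges G \<Longrightarrow>
      {x, y} \<notin> edges G"
    and no_cherry: "x \<notin> range v \<Longrightarrow> y \<notin> range v \<Longrightarrow> z \<notin> range v \<Longrightarrow>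
      {v i, x} \<in> edges G \<Longrightarrow> {v j, z} \<in> edges G \<Longrightarrow> {x, y} \<in> edges G \<Longrightarrow> {y, z} \<in> edges G \<Longrightarrow> x = z"
    and cover: "e \<in> edges G \<Longrightarrow> \<exists>x\<in>e. \<exists>i. x = v i \<or> {v i, x} \<in> edges G"
begin

definition tail :: "int \<Rightarrow> 'a \<Rightarrow> 'a \<Rightarrow> bool" where
  "tail i a b \<longleftrightarrow> a \<notin> range v \<and> b \<notin> range v \<and> {v i, a} \<in> edges G \<and> {a, b} \<in> edges G"

definition pend :: "int \<Rightarrow> 'a \<Rightarrow> bool" where
  "pend i x \<longleftrightarrow> x \<notin> range v \<and> {v i, x} \<in> edges G"

lemma ring_edge: "j = i + 1 \<Longrightarrow> {v i, v j} \<in> edges G"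
  using ring by simp

lemma v_period: "v (i + g) = v i"
  by (simp add: v_eq)

lemma v_neq: "i \<noteq> j \<Longrightarrow> \<bar>i - j\<bar> < g \<Longrightarrow> v i \<noteq> v j"
  using not_dvd_small[of "i - j" g] by (simp add: v_eq)

lemma v_far:
  assumes "2 \<le> \<bar>i - j\<bar>" "\<bar>i - j\<bar> \<le> g - 2"
  shows "v i \<noteq> v j" "{v i, v j} \<notin> edges G"
  using assms chord[of i j] v_neq[of i j] v_neq[of j "i + 1"] v_neq[of j "i - 1"] by auto

text \<open>Starting indices three apart leave one cycle vertex between the edges. The successors
  are separate variables so that the rule unifies with literal indices such as \<open>v 5\<close>
  and \<open>v 6\<close>.\<close>

lemma ring_apart:
  assumes "3 \<le> \<bar>i - j\<bar>" "\<bar>i - j\<bar> \<le> g - 3" "i' = i + 1" "j' = j + 1"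
  shows "apart G {v i, v i'} {v j, v j'}"
  using assms v_far[of i j] v_far[of i' j] v_far[of i j'] v_far[of i' j']
  by (auto simp: apart_def)

text \<open>The bounds are asymmetric because the pendant edge meets the cycle at \<open>i\<close>
  alone, while the cycle edge also occupies \<open>j + 1\<close>.\<close>

lemma pend_ring_apart:
  assumes "pend i x" "2 \<le> j - i \<and> j - i \<le> g - 3 \<or> 3 \<le> i - j \<and> i - j \<le> g - 2" "j' = j + 1"
  shows "apart G {v i, x} {v j, v j'}"
proof -
  have "x \<notin> range v" "{v i, x} \<in> edges G" using assms by (auto simp: pend_def)
  then show ?thesis
    using assms(2,3) v_far[of i j] v_far[of i j'] foot[of x i j] foot[of x i j']
    by (auto simp: apart_def insert_commute)
qed

lemma pend_pend_apart:
  assumes "pend i x" "pend j y" "2 \<le> \<bar>i - j\<bar>" "\<bar>i - j\<bar> \<le> g - 2"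
  shows "apart G {v i, x} {v j, y}"
proof -
  have "x \<notin> range v" "{v i, x} \<in> edges G" "y \<notin> range v" "{v j, y} \<in> edges G"
    using assms by (auto simp: pend_def)
  then show ?thesis
    using assms(3,4) v_far[of i j] foot[of x i j] foot[of y i j] no_edge[of x y i j]
    by (auto simp: apart_def insert_commute)
qed

text \<open>By \<open>no_edge\<close>, \<open>b\<close> is not adjacent to the cycle. So
  \<open>cover\<close> puts \<open>y\<close> next to the cycle, and \<open>no_cherry\<close>
  identifies it with \<open>a\<close>.\<close>

lemma leaf:
  assumes "tail i a b" "{b, y} \<in> edges G"
  shows "y = a"
proof -
  have ab: "a \<notin> range v" "b \<notin> range v" "{v i, a} \<in> edges G" "{a, b} \<in> edges G"
    using assms(1) by (auto simp: tail_def)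
  then have b: "{v k, b} \<notin> edges G" for k using no_edge[of a b i k] by blast
  then have "y \<notin> range v" using assms(2) by (auto simp: insert_commute)
  moreover from this obtain k where "{v k, y} \<in> edges G"
    using cover[OF assms(2)] ab b by auto
  ultimately show ?thesis using no_cherry[of a b y i k] ab assms(2) by blast
qed

text \<open>The neighbours of \<open>a\<close> are \<open>v i\<close> and leaves whose only edge
  goes to \<open>a\<close>. An edge conflicting with \<open>{a, b}\<close> therefore contains
  \<open>v i\<close> or \<open>a\<close>.\<close>

lemma tail_apart:
  assumes t: "tail i a b" and f: "f \<in> edges G" "v i \<notin> f" "a \<notin> f"
  shows "apart G f {a, b}"
proof -
  have ab: "a \<notin> range v" "{v i, a} \<in> edges G"
    using t by (auto simp: tail_def)
  have "x \<noteq> a \<and> {x, a} \<notin> edges G \<and> x \<noteq> b \<and> {x, b} \<notin> edges G" if x: "x \<in> f" for x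
  proof -
    obtain z where z: "f = {x, z}" using edge_other_end[OF simple f(1) x] by metis
    have "{x, a} \<notin> edges G"
    proof
      assume xa: "{x, a} \<in> edges G"
      show False
      proof (cases "x \<in> range v")
        case True
        then show False using foot[of a i] ab xa f(2) x by force
      next
        case False
        then have "tail i a x" using ab xa by (simp add: tail_def insert_commute)
        then show False using leaf f z by auto
      qed
    qed
    then show ?thesis using leaf[OF t] z f x by (auto simp: insert_commute)
  qed
  then show ?thesis by (auto simp: apart_def)
qed

text \<open>Such an \<open>f\<close> could reach \<open>v i\<close> only through a neighbour
  \<open>y\<close> off the cycle. Its other end would then complete a tail or, by
  \<open>foot\<close>, be \<open>v i\<close> itself.\<close>

lemma avoid:
  assumes f: "f \<in> edges G" and no_tail: "\<And>a b. \<not> tail i a b"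
    and "v (i - 1) \<notin> f" "v i \<notin> f" "v (i + 1) \<notin> f" and y: "y \<in> f"
  shows "y \<noteq> v i" "{y, v i} \<notin> edges G"
proof -
  show "y \<noteq> v i" using assms by auto
  show "{y, v i} \<notin> edges G"
  proof
    assume e: "{y, v i} \<in> edges G"
    then have y': "y \<notin> range v" using chord[of i] assms by (force simp: insert_commute)
    obtain z where z: "f = {y, z}" using edge_other_end[OF simple f y] by metis
    then have "z \<in> range v" using no_tail[of y z] e y' f by (auto simp: tail_def insert_commute)
    then show False using foot[OF y', of i] e z f \<open>v i \<notin> f\<close> by (force simp: insert_commute)
  qed
qed

text \<open>Where there are no tails, this is the converse of \<open>ring_blocks\<close>: the
  conflict is decided by four cycle vertices, so \<open>dom\<close> becomes a statement about index
  intervals.\<close>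

lemma avoid_ring:
  assumes "f \<in> edges G" "\<And>a b. \<not> tail i a b" "\<And>a b. \<not> tail j a b" "j = i + 1"
    "\<And>k. i - 1 \<le> k \<Longrightarrow> k \<le> i + 2 \<Longrightarrow> v k \<notin> f"
  shows "apart G f {v i, v j}"
  using assms avoid[of f i] avoid[of f j] by (auto simp: apart_def)

lemma ring_blocks:
  assumes "apart G f {v i, v j}" "j = i + 1" "i - 1 \<le> k" "k \<le> i + 2"
  shows "v k \<notin> f"
proof -
  have "k = i - 1 \<or> k = i \<or> k = i + 1 \<or> k = i + 2" using assms by linarith
  then show ?thesis
    using assms(1,2) ring_edge[of i "i - 1"] ring_edge[of "i + 2" "i + 1"]
    by (auto simp: apart_def insert_commute)
qed

lemma pend_blocks:
  assumes "apart G f {v i, x}" "i - 1 \<le> k" "k \<le> i + 1"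
  shows "v k \<notin> f"
proof -
  have "k = i - 1 \<or> k = i \<or> k = i + 1" using assms by linarith
  then show ?thesis
    using assms(1) ring_edge[of i "i - 1"] ring_edge[of "i + 1" i]
    by (auto simp: apart_def insert_commute)
qed

section \<open>Exchanges at tails\<close>

lemmas exchange = well_indumatched_exchange[OF simple wim]

text \<open>Trade the cycle edge between the two feet for both outer tail edges. Whatever is apart
  from the cycle edge avoids \<open>v i\<close>, \<open>v (i + 1)\<close>, \<open>a\<close> and
  \<open>a'\<close>, so \<open>tail_apart\<close> applies twice.\<close>

lemma tails_not_adjacent:
  assumes t: "tail i a b" and t': "tail (i + 1) a' b'"
  shows False
proof (rule exchange[of "[]" "[{v i, v (i + 1)}]" "[{a, b}, {a', b'}]"])
  show E: "set ([] @ [{v i, v (i + 1)}] @ [{a, b}, {a', b'}]) \<subseteq> edges G"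
    using t t' ring by (auto simp: tail_def)
  have "v i \<noteq> v (i + 1)" using v_neq[of i "i + 1"] g9 by simp
  then have "a \<noteq> a'" using foot[of a i "i + 1"] t t' by (auto simp: tail_def)
  moreover have "a \<noteq> b'" using no_edge[of a' a "i + 1" i] t t' by (auto simp: tail_def)
  ultimately have "apart G {a', b'} {a, b}" using tail_apart[OF t, of "{a', b'}"] t t' by (auto simp: tail_def)
  then show "sorted_wrt (apart G) ([] @ [{a, b}, {a', b'}])" by (simp add: apart_sym)
  fix f d
  assume f: "f \<in> edges G" "\<And>e. e \<in> set ([] @ [{v i, v (i + 1)}]) \<Longrightarrow> apart G f e"
    and "d \<in> set [{a, b}, {a', b'}]"
  moreover from f have "v i \<notin> f" "v (i + 1) \<notin> f" "a \<notin> f" "a' \<notin> f"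
    using t t' by (auto simp: apart_def tail_def insert_commute)
  ultimately show "apart G f d" using tail_apart t t' by auto
qed auto

text \<open>Otherwise \<open>{v i, v (i + 1)}\<close> could be traded for \<open>{a, b}\<close> and
  \<open>{v (i + 1), v (i + 2)}\<close>. The kept edge at \<open>i + 4\<close> blocks
  \<open>v (i + 3)\<close>, after which only a tail at \<open>i + 2\<close> could provide an edge in
  conflict with the second new edge.\<close>

lemma tail_step:
  assumes t: "tail i a b"
  shows "\<exists>a b. tail (i + 2) a b"
proof (rule ccontr)
  assume no_tail: "\<nexists>a b. tail (i + 2) a b"
  let ?q = "{v (i + 4), v (i + 5)}" and ?e = "{v i, v (i + 1)}" and ?d = "{v (i + 1), v (i + 2)}"
  have E: "?q \<in> edges G" "?e \<in> edges G" "?d \<in> edges G" "{a, b} \<in> edges G"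
    using t by (auto simp: tail_def intro: ring_edge)
  have tail_far: "apart G {a, b} {v j, v k}" if "k = j + 1" "v j \<noteq> v i" "v k \<noteq> v i" for j k
    using tail_apart[OF t ring_edge[OF that(1)]] t that by (auto simp: tail_def intro: apart_sym)
  show False
  proof (rule exchange[of "[?q]" "[?e]" "[{a, b}, ?d]"])
    show "sorted_wrt (apart G) ([?q] @ [?e])"
      using ring_apart[of "i + 4" i "i + 5" "i + 1"] g9 by simp
    show "sorted_wrt (apart G) ([?q] @ [{a, b}, ?d])"
      using ring_apart[of "i + 4" "i + 1" "i + 5" "i + 2"] g9
        tail_far[of "i + 5" "i + 4"] tail_far[of "i + 2" "i + 1"]
        v_neq[of "i + 1" i] v_neq[of "i + 2" i] v_neq[of "i + 4" i] v_neq[of "i + 5" i]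
      by (simp add: apart_sym)
    fix f d
    assume f: "f \<in> edges G" "\<And>e. e \<in> set ([?q] @ [?e]) \<Longrightarrow> apart G f e"
      and d: "d \<in> set [{a, b}, ?d]"
    have f': "apart G f ?e" "apart G f ?q" using f by auto
    have "v i \<notin> f" "a \<notin> f" using f' t by (auto simp: apart_def tail_def insert_commute)
    then have "apart G f {a, b}" using tail_apart[OF t f(1)] by blast
    moreover have "apart G f ?d"
    proof -
      have "v (i + 3) \<notin> f" "v (i + 2) \<notin> f" "v (i + 1) \<notin> f"
        using ring_blocks[OF f'(1)] ring_blocks[OF f'(2)] by auto
      then have "y \<noteq> v (i + 2) \<and> {y, v (i + 2)} \<notin> edges G" if "y \<in> f" for y
        using avoid[OF f(1), of "i + 2" y] no_tail that by (auto simp: algebra_simps)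
      then show ?thesis using f'(1) by (auto simp: apart_def)
    qed
    ultimately show "apart G f d" using d by auto
  qed (use E in auto)
qed

section \<open>Cycles that carry pendant edges but no tails\<close>

context
  assumes no_tail: "\<And>i a b. \<not> tail i a b"
begin

lemma edge_off_cycle:
  assumes "f \<in> edges G" "x \<in> f" "x \<notin> range v"
  shows "\<exists>k. f = {v k, x}"
proof -
  obtain z where z: "f = {x, z}" using edge_other_end[OF simple assms(1,2)] by metis
  have "z \<in> range v"
  proof (rule ccontr)
    assume z': "z \<notin> range v"
    then obtain k where "{v k, x} \<in> edges G \<or> {v k, z} \<in> edges G"
      using cover[OF assms(1)] assms(3) z by auto
    then show False
      using no_tail[of k x z] no_tail[of k z x] z' assms z by (auto simp: tail_def insert_commute)
  qed
  then show ?thesis using z by (auto simp: insert_commute)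
qed

lemma avoid_pend:
  assumes f: "f \<in> edges G" and p: "pend i x" and "\<And>k. i - 1 \<le> k \<Longrightarrow> k \<le> i + 1 \<Longrightarrow> v k \<notin> f"
  shows "apart G f {v i, x}"
proof -
  have v: "v (i - 1) \<notin> f" "v i \<notin> f" "v (i + 1) \<notin> f" using assms(3) by auto
  have x: "x \<notin> range v" "{v i, x} \<in> edges G" using p by (auto simp: pend_def)
  have "y \<noteq> x \<and> {y, x} \<notin> edges G" if y: "y \<in> f" for y
  proof
    show "y \<noteq> x"
    proof
      assume "y = x"
      then obtain k where "f = {v k, x}" using edge_off_cycle[OF f, of x] x y by blast
      then show False using foot[OF x(1), of i k] f x v by auto
    qed
    show "{y, x} \<notin> edges G"
    proof
      assume e: "{y, x} \<in> edges G"
      then obtain k where "{y, x} = {v k, x}" using edge_off_cycle[of "{y, x}" x] x by auto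
      then have "y = v k" using edge_neq[OF simple e] by (auto simp: doubleton_eq_iff)
      then show False using foot[OF x(1), of i k] e x v y by auto
    qed
  qed
  then show ?thesis
    using avoid[OF f no_tail v] by (auto simp: apart_def)
qed

text \<open>This closes gaps of one vertex between blocked intervals: a vertex without pendant edge
  has only its two cycle neighbours.\<close>

lemma avoid_vertex:
  assumes "f \<in> edges G" "\<And>x. \<not> pend i x" "v (i - 1) \<notin> f" "v (i + 1) \<notin> f"
  shows "v i \<notin> f"
proof
  assume "v i \<in> f"
  then obtain z where z: "f = {v i, z}" using edge_other_end[OF simple assms(1)] by metis
  then have "z \<in> range v" using assms(1,2) by (auto simp: pend_def)
  then obtain j where "z = v j" by auto
  then show False using chord[of i j] assms(1,3,4) z by auto
qed

text \<open>Once all \<open>g\<close> cycle vertices are blocked, no further edge exists and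
  \<open>dom\<close> holds vacuously.\<close>

lemma meets_cycle:
  assumes "f \<in> edges G"
  obtains r where "0 \<le> r" "r < g" "v (i + r) \<in> f"
proof -
  obtain x where x: "x \<in> f" using edge_cases[OF simple assms] by (metis insertI1)
  obtain j where j: "v j \<in> f"
    using edge_off_cycle[OF assms x] x by blast
  have "v (i + (j - i) mod g) = v j"
    by (simp add: v_eq mod_eq_dvd_iff[symmetric] mod_simps)
  then show thesis using that[of "(j - i) mod g"] j g9 by simp
qed

text \<open>The pendant edge at \<open>i\<close> and the cycle edge at \<open>i + 2\<close> are
  compatible, but both conflict with the cycle edge at \<open>i + 1\<close>, which is traded for
  them. The kept edges at \<open>i - 3\<close> and \<open>i + 5\<close> extend the blocked interval
  to \<open>i - 4\<close> up to \<open>i + 7\<close>.\<close>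

lemma no_pend:
  assumes g: "12 \<le> g"
  shows "\<not> pend i x"
proof
  assume p: "pend i x"
  let ?qs = "[{v (i - 3), v (i - 2)}, {v (i + 5), v (i + 6)}]" and ?es = "[{v (i + 1), v (i + 2)}]"
  let ?ds = "[{v i, x}, {v (i + 2), v (i + 3)}]"
  show False
  proof (rule exchange[of ?qs ?es ?ds])
    show "set (?qs @ ?es @ ?ds) \<subseteq> edges G"
      using p by (auto simp: pend_def intro!: ring_edge)
    show "sorted_wrt (apart G) (?qs @ ?es)" "sorted_wrt (apart G) (?qs @ ?ds)"
      using g by (auto intro!: ring_apart pend_ring_apart[OF p] apart_sym[OF pend_ring_apart[OF p]])
    fix f d
    assume f: "f \<in> edges G" "\<And>e. e \<in> set (?qs @ ?es) \<Longrightarrow> apart G f e" and d: "d \<in> set ?ds"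
    then have *: "apart G f {v (i - 3), v (i - 2)}" "apart G f {v (i + 5), v (i + 6)}"
      "apart G f {v (i + 1), v (i + 2)}" by auto
    have "v k \<notin> f" if "i - 4 \<le> k" "k \<le> i + 7" for k
      using ring_blocks[OF *(1), of k] ring_blocks[OF *(2), of k] ring_blocks[OF *(3), of k] that
      by linarith
    then show "apart G f d"
      using d f(1) no_tail by (auto intro!: avoid_ring avoid_pend[OF _ p])
  qed simp
qed

text \<open>Three edges at spacing 4 block all twelve vertices, as index 11 is index -1; spacing 3
  makes room for four edges.\<close>

lemma no_tail_12:
  assumes g: "g = 12"
  shows False
proof -
  let ?es = "[{v 0, v 1}, {v 4, v 5}, {v 8, v 9}]"
  let ?ds = "[{v 0, v 1}, {v 3, v 4}, {v 6, v 7}, {v 9, v 10}]"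
  show False
  proof (rule exchange[of "[]" ?es ?ds])
    show "set ([] @ ?es @ ?ds) \<subseteq> edges G" by (auto intro!: ring_edge)
    show "sorted_wrt (apart G) ([] @ ?es)" "sorted_wrt (apart G) ([] @ ?ds)"
      using g by (auto intro!: ring_apart)
    fix f d
    assume f: "f \<in> edges G" "\<And>e. e \<in> set ([] @ ?es) \<Longrightarrow> apart G f e"
    then have *: "apart G f {v 0, v 1}" "apart G f {v 4, v 5}" "apart G f {v 8, v 9}" by auto
    have v: "v k \<notin> f" if "-1 \<le> k" "k \<le> 10" for k
      using ring_blocks[OF *(1), of k] ring_blocks[OF *(2), of k] ring_blocks[OF *(3), of k] that
      by linarith
    obtain r where r: "0 \<le> r" "r < g" "v (0 + r) \<in> f" using meets_cycle[OF f(1)] by metis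
    have "r = 11" using r v[of r] g by (cases "r \<le> 10") auto
    then show "apart G f d" using v[of "-1"] v_period[of "-1"] r g by simp
  qed simp
qed

text \<open>The edges at 0, 5 and 10 leave the gaps 3 and 8, which \<open>no_pend\<close> makes
  bare. Hence the edge at 5 can be replaced by those at 3 and 7. The distance 10 between the kept
  edges has to be at most \<open>g - 3\<close>, whence 13.\<close>

lemma no_tail_13:
  assumes g: "13 \<le> g"
  shows False
proof -
  let ?qs = "[{v 0, v 1}, {v 10, v 11}]" and ?es = "[{v 5, v 6}]"
  let ?ds = "[{v 3, v 4}, {v 7, v 8}]"
  show False
  proof (rule exchange[of ?qs ?es ?ds])
    show "set (?qs @ ?es @ ?ds) \<subseteq> edges G" by (auto intro!: ring_edge)
    show "sorted_wrt (apart G) (?qs @ ?es)" "sorted_wrt (apart G) (?qs @ ?ds)"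
      using g by (auto intro!: ring_apart)
    fix f d
    assume f: "f \<in> edges G" "\<And>e. e \<in> set (?qs @ ?es) \<Longrightarrow> apart G f e" and d: "d \<in> set ?ds"
    then have *: "apart G f {v 0, v 1}" "apart G f {v 10, v 11}" "apart G f {v 5, v 6}" by auto
    have v: "v k \<notin> f" if "-1 \<le> k" "k \<le> 12" "k \<noteq> 3" "k \<noteq> 8" for k
      using ring_blocks[OF *(1), of k] ring_blocks[OF *(2), of k] ring_blocks[OF *(3), of k] that
      by linarith
    have "v 3 \<notin> f" "v 8 \<notin> f"
      using avoid_vertex[OF f(1), of 3] avoid_vertex[OF f(1), of 8] no_pend g
        v[of 2] v[of 4] v[of 7] v[of 9] by auto
    with v have "v k \<notin> f" if "-1 \<le> k" "k \<le> 12" for k using that by metis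
    then show "apart G f d"
      using d f(1) no_tail by (auto intro!: avoid_ring)
  qed simp
qed

lemma pend_shift: "pend i x \<Longrightarrow> g dvd i - j \<Longrightarrow> pend j x"
  unfolding pend_def by (metis v_eq)

text \<open>The edges at \<open>i + 1\<close> and \<open>i + 5\<close> block everything except
  \<open>i + 8\<close>, which is \<open>i - 1\<close>. If that vertex were bare it would be blocked
  too, and the edge at \<open>i + 1\<close> could be traded for two.\<close>

lemma pend_step_9:
  assumes g: "g = 9" and p: "pend i x"
  shows "\<exists>x. pend (i - 1) x"
proof (rule ccontr)
  assume no_p: "\<nexists>x. pend (i - 1) x"
  let ?qs = "[{v (i + 5), v (i + 6)}]" and ?es = "[{v (i + 1), v (i + 2)}]"
  let ?ds = "[{v i, x}, {v (i + 2), v (i + 3)}]"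
  show False
  proof (rule exchange[of ?qs ?es ?ds])
    show "set (?qs @ ?es @ ?ds) \<subseteq> edges G"
      using p by (auto simp: pend_def intro!: ring_edge)
    show "sorted_wrt (apart G) (?qs @ ?es)" "sorted_wrt (apart G) (?qs @ ?ds)"
      using g by (auto intro!: ring_apart pend_ring_apart[OF p] apart_sym[OF pend_ring_apart[OF p]])
    fix f d
    assume f: "f \<in> edges G" "\<And>e. e \<in> set (?qs @ ?es) \<Longrightarrow> apart G f e" and d: "d \<in> set ?ds"
    then have *: "apart G f {v (i + 5), v (i + 6)}" "apart G f {v (i + 1), v (i + 2)}" by auto
    have v: "v k \<notin> f" if "i \<le> k" "k \<le> i + 7" for k
      using ring_blocks[OF *(1), of k] ring_blocks[OF *(2), of k] that by linarith
    then have "v (i - 2) \<notin> f" using v_period[of "i - 2"] v[of "i + 7"] g by (simp add: add.commute)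
    then have "v (i - 1) \<notin> f"
      using avoid_vertex[OF f(1), of "i - 1"] no_p v[of i] by simp
    then have "v k \<notin> f" if "i - 1 \<le> k" "k \<le> i + 7" for k
      using v[of k] that by (cases "k = i - 1") auto
    then show "apart G f d"
      using d f(1) no_tail by (auto intro!: avoid_ring avoid_pend[OF _ p])
  qed simp
qed

lemma no_tail_9:
  assumes g: "g = 9"
  shows False
proof (cases "\<exists>i x. pend i x")
  case True
  then obtain i where i: "\<exists>x. pend i x" by blast
  have down: "\<exists>x. pend (i - int n) x" for n
  proof (induction n)
    case (Suc n)
    then show ?case using pend_step_9[OF g, of "i - int n"] by (auto simp: algebra_simps)
  qed (use i in simp)
  have pend: "\<exists>x. pend j x" for j
  proof -
    have "g dvd (i - int (nat ((i - j) mod g))) - j"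
      using g by (simp add: mod_eq_dvd_iff[symmetric] mod_simps)
    then show ?thesis using down pend_shift by metis
  qed
  then obtain x where x: "pend j (x j)" for j by metis
  \<comment> \<open>Every vertex now has a pendant edge. Three cycle edges block all nine vertices,
    but four pendant edges at pairwise distance at least two also fit.\<close>
  let ?es = "[{v 0, v 1}, {v 3, v 4}, {v 6, v 7}]"
  let ?ds = "[{v 0, x 0}, {v 2, x 2}, {v 4, x 4}, {v 6, x 6}]"
  show False
  proof (rule exchange[of "[]" ?es ?ds])
    show "set ([] @ ?es @ ?ds) \<subseteq> edges G" using x by (auto simp: pend_def intro!: ring_edge)
    show "sorted_wrt (apart G) ([] @ ?es)" "sorted_wrt (apart G) ([] @ ?ds)"
      using g x by (auto intro!: ring_apart pend_pend_apart[OF x x])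
    fix f d
    assume f: "f \<in> edges G" "\<And>e. e \<in> set ([] @ ?es) \<Longrightarrow> apart G f e"
    then have *: "apart G f {v 0, v 1}" "apart G f {v 3, v 4}" "apart G f {v 6, v 7}" by auto
    have v: "v k \<notin> f" if "-1 \<le> k" "k \<le> 8" for k
      using ring_blocks[OF *(1), of k] ring_blocks[OF *(2), of k] ring_blocks[OF *(3), of k] that
      by linarith
    obtain r where r: "0 \<le> r" "r < g" "v (0 + r) \<in> f" using meets_cycle[OF f(1)] by metis
    then show "apart G f d" using v[of r] g by simp
  qed simp
next
  case False
  \<comment> \<open>Without pendant edges, two edges leave only the bare vertex 7, while three edges
    fit at spacing 3.\<close>
  let ?es = "[{v 0, v 1}, {v 4, v 5}]"
  let ?ds = "[{v 0, v 1}, {v 3, v 4}, {v 6, v 7}]"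
  show False
  proof (rule exchange[of "[]" ?es ?ds])
    show "set ([] @ ?es @ ?ds) \<subseteq> edges G" by (auto intro!: ring_edge)
    show "sorted_wrt (apart G) ([] @ ?es)" "sorted_wrt (apart G) ([] @ ?ds)"
      using g by (auto intro!: ring_apart)
    fix f d
    assume f: "f \<in> edges G" "\<And>e. e \<in> set ([] @ ?es) \<Longrightarrow> apart G f e"
    then have *: "apart G f {v 0, v 1}" "apart G f {v 4, v 5}" by auto
    have v: "v k \<notin> f" if "-1 \<le> k" "k \<le> 6" for k
      using ring_blocks[OF *(1), of k] ring_blocks[OF *(2), of k] that by linarith
    have v8: "v 8 \<notin> f" using v[of "-1"] v_period[of "-1"] g by simp
    have v7: "v 7 \<notin> f" using avoid_vertex[OF f(1), of 7] False v[of 6] v8 by simp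
    obtain r where r: "0 \<le> r" "r < g" "v (0 + r) \<in> f" using meets_cycle[OF f(1)] by metis
    then have "r \<le> 6 \<or> r = 7 \<or> r = 8" using g by linarith
    then show "apart G f d" using r v[of r] v7 v8 by auto
  qed simp
qed

text \<open>Index \<open>i + 8\<close> is \<open>i - 2\<close>. The pendant edge there blocks
  \<open>i + 7\<close> to \<open>i + 9\<close>, so together with the cycle edges at
  \<open>i + 1\<close> and \<open>i + 5\<close> the whole cycle is blocked, and the edge at
  \<open>i + 1\<close> can be traded for two.\<close>

lemma pend_10:
  assumes g: "g = 10" and p: "pend i x" and q: "pend (i + 8) y"
  shows False
proof -
  let ?qs = "[{v (i + 5), v (i + 6)}, {v (i + 8), y}]" and ?es = "[{v (i + 1), v (i + 2)}]"
  let ?ds = "[{v i, x}, {v (i + 2), v (i + 3)}]"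
  show False
  proof (rule exchange[of ?qs ?es ?ds])
    show "set (?qs @ ?es @ ?ds) \<subseteq> edges G"
      using p q by (auto simp: pend_def intro!: ring_edge)
    show "sorted_wrt (apart G) (?qs @ ?es)" "sorted_wrt (apart G) (?qs @ ?ds)"
      using g by (auto intro!: ring_apart pend_ring_apart[OF p] pend_ring_apart[OF q]
          apart_sym[OF pend_ring_apart[OF p]] apart_sym[OF pend_ring_apart[OF q]]
          pend_pend_apart[OF q p])
    fix f d
    assume f: "f \<in> edges G" "\<And>e. e \<in> set (?qs @ ?es) \<Longrightarrow> apart G f e" and d: "d \<in> set ?ds"
    then have *: "apart G f {v (i + 5), v (i + 6)}" "apart G f {v (i + 8), y}"
      "apart G f {v (i + 1), v (i + 2)}" by auto
    have v: "v k \<notin> f" if "i \<le> k" "k \<le> i + 9" for k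
      using ring_blocks[OF *(1), of k] pend_blocks[OF *(2), of k] ring_blocks[OF *(3), of k] that
      by linarith
    then have "v (i - 1) \<notin> f" using v_period[of "i - 1"] v[of "i + 9"] g by (simp add: add.commute)
    then have "v k \<notin> f" if "i - 1 \<le> k" "k \<le> i + 9" for k
      using v[of k] that by (cases "k = i - 1") auto
    then show "apart G f d"
      using d f(1) no_tail by (auto intro!: avoid_ring avoid_pend[OF _ p])
  qed simp
qed

text \<open>The opposite edges at \<open>i\<close> and \<open>i + 5\<close> block all but
  \<open>i + 3\<close> and \<open>i + 8\<close>. Were both bare, these two edges would dominate
  everything, although three edges fit.\<close>

lemma pend_or_pend_10:
  assumes g: "g = 10"
  shows "\<exists>x. pend (i + 3) x \<or> pend (i + 8) x"
proof (rule ccontr)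
  assume no_p: "\<not> ?thesis"
  let ?es = "[{v i, v (i + 1)}, {v (i + 5), v (i + 6)}]"
  let ?ds = "[{v i, v (i + 1)}, {v (i + 3), v (i + 4)}, {v (i + 6), v (i + 7)}]"
  show False
  proof (rule exchange[of "[]" ?es ?ds])
    show "set ([] @ ?es @ ?ds) \<subseteq> edges G" by (auto intro!: ring_edge)
    show "sorted_wrt (apart G) ([] @ ?es)" "sorted_wrt (apart G) ([] @ ?ds)"
      using g by (auto intro!: ring_apart)
    fix f d
    assume f: "f \<in> edges G" "\<And>e. e \<in> set ([] @ ?es) \<Longrightarrow> apart G f e"
    then have *: "apart G f {v i, v (i + 1)}" "apart G f {v (i + 5), v (i + 6)}" by auto
    have v: "v k \<notin> f" if "i - 1 \<le> k" "k \<le> i + 7" "k \<noteq> i + 3" for k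
      using ring_blocks[OF *(1), of k] ring_blocks[OF *(2), of k] that by linarith
    have v9: "v (i + 9) \<notin> f" using v[of "i - 1"] v_period[of "i - 1"] g by (simp add: add.commute)
    have v38: "v (i + 3) \<notin> f" "v (i + 8) \<notin> f"
      using avoid_vertex[OF f(1), of "i + 3"] avoid_vertex[OF f(1), of "i + 8"] no_p v9
        v[of "i + 2"] v[of "i + 4"] v[of "i + 7"] by (auto simp: algebra_simps)
    obtain r where r: "0 \<le> r" "r < g" "v (i + r) \<in> f" using meets_cycle[OF f(1)] by metis
    then have "r \<le> 7 \<or> r = 8 \<or> r = 9" using g by linarith
    then show "apart G f d" using r v[of "i + r"] v38 v9 by auto
  qed simp
qed

lemma no_tail_10:
  assumes g: "g = 10"
  shows False
proof -
  have step: "\<exists>y. pend (i + 3) y" if "\<exists>x. pend i x" for i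
    using that pend_or_pend_10[OF g, of i] pend_10[OF g, of i] by blast
  obtain i x where x: "pend i x" using pend_or_pend_10[OF g] by blast
  have up: "\<exists>y. pend (i + 3 * int n) y" for n
  proof (induction n)
    case (Suc n)
    then show ?case using step[of "i + 3 * int n"] by (simp add: algebra_simps)
  qed (use x in auto)
  \<comment> \<open>Six steps of 3 make 18, which is 8 modulo 10, the offset excluded by
    \<open>pend_10\<close>.\<close>
  obtain y where "pend (i + 3 * int 6) y" using up by blast
  then have "pend (i + 8) y" by (rule pend_shift) (simp add: g)
  then show False using pend_10[OF g x] by blast
qed

lemma no_tail_contradiction:
  assumes "g \<noteq> 11"
  shows False
proof -
  have "g = 9 \<or> g = 10 \<or> g = 12 \<or> 13 \<le> g" using assms g9 by linarith
  then show False using no_tail_9 no_tail_10 no_tail_12 no_tail_13 by blast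
qed

end

text \<open>One tail exists, and \<open>tail_step\<close> carries it around in steps of two. For odd
  \<open>g\<close> a second round would also reach \<open>k + 1\<close>, giving adjacent
  tails.\<close>

lemma tails_alternate:
  assumes "g \<noteq> 11"
  shows "even g" "\<exists>k. \<forall>i. even (i - k) \<longrightarrow> (\<exists>a b. tail i a b)"
proof -
  obtain k where k: "\<exists>a b. tail k a b" using no_tail_contradiction assms by blast
  have shift: "tail j a b" if "tail i a b" "g dvd i - j" for i j a b
    using that unfolding tail_def by (metis v_eq)
  have up: "\<exists>a b. tail (k + 2 * int n) a b" for n
  proof (induction n)
    case (Suc n)
    then show ?case using tail_step[of "k + 2 * int n"] by (auto simp: algebra_simps)
  qed (use k in simp)
  have all: "\<exists>a b. tail i a b" if i: "even (i - k)" for i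
  proof -
    obtain m where m: "i = k + 2 * m" using i[unfolded dvd_def] by (auto simp: algebra_simps)
    have "g dvd (k + 2 * int (nat (m mod g))) - i"
      using g9 m by (simp add: mod_eq_dvd_iff[symmetric] mod_simps)
    then show ?thesis using up shift by metis
  qed
  then show "\<exists>k. \<forall>i. even (i - k) \<longrightarrow> (\<exists>a b. tail i a b)" by blast
  show "even g"
  proof (rule ccontr)
    assume "odd g"
    then obtain a b where "tail (k + 1 + g) a b" using all[of "k + 1 + g"] by auto
    then have "tail (k + 1) a b" using shift by simp
    then show False using k tails_not_adjacent by blast
  qed
qed

end

section \<open>Shortest cycles\<close>

locale shortest_cycle =
  fixes G :: "'a ugraph" and vs :: "'a list"
  assumes simple: "simple_graph G" and girth: "girth G = enat (length vs)"
    and dist: "distinct vs" and len: "9 \<le> length vs" and cycle: "cycle_of vs \<in> cycles G"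
begin

lemma nonempty: "vs \<noteq> []"
  using len by auto

lemma range_cyc_vs: "range (cyc vs) = set vs"
  using range_cyc nonempty by blast

lemma cyc_eq: "cyc vs i = cyc vs j \<longleftrightarrow> int (length vs) dvd i - j"
  using cyc_eq_iff[OF dist nonempty] .

lemma ring: "{cyc vs i, cyc vs (i + 1)} \<in> edges G"
  using cyc_edge[OF nonempty, of i] cycle by (auto simp: cycles_def subgraph_def)

text \<open>The arc of \<open>d\<close> edges from \<open>i\<close> together with \<open>xs\<close>
  is a closed walk through \<open>d + 1 + length xs\<close> distinct vertices; the bound 2 makes
  this at least three.\<close>

lemma detour_length:
  assumes xs: "distinct xs" "set xs \<inter> set vs = {}"
    and walk: "successively (\<lambda>x y. {x, y} \<in> edges G) (cyc vs (i + int d) # xs @ [cyc vs i])"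
    and d: "d < length vs" "2 \<le> d + length xs"
  shows "length vs \<le> Suc d + length xs"
proof -
  let ?w = "\<lambda>k. cyc vs (i + int k)"
  let ?ws = "map ?w [0..<Suc d] @ xs"
  have "inj_on ?w {0..<Suc d}"
  proof
    fix k l assume "k \<in> {0..<Suc d}" "l \<in> {0..<Suc d}" "?w k = ?w l"
    then have "int (length vs) dvd int k - int l" "\<bar>int k - int l\<bar> < int (length vs)"
      using d by (auto simp: cyc_eq)
    then show "k = l" using not_dvd_small[of "int k - int l"] by force
  qed
  moreover have "set xs \<inter> ?w ` {0..<Suc d} = {}" using xs(2) range_cyc_vs by auto
  ultimately have "distinct ?ws" using xs(1) by (auto simp: distinct_map simp del: upt_Suc)
  moreover have "hd ?ws = cyc vs i" by (simp add: upt_conv_Cons del: upt_Suc)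
  moreover have "successively (\<lambda>x y. {x, y} \<in> edges G)
      (map ?w [0..<d] @ cyc vs (i + int d) # xs @ [cyc vs i])"
  proof -
    have step: "{?w k, ?w (Suc k)} \<in> edges G" for k
      using ring[of "i + int k"] by (simp add: ac_simps)
    have "successively (\<lambda>x y. {x, y} \<in> edges G) (map ?w [0..<d])"
      using step by (simp add: successively_conv_nth del: of_nat_Suc)
    then show ?thesis
      using walk step[of "d - 1"]
      by (cases "d = 0") (simp_all add: successively_append_iff last_map)
  qed
  ultimately show ?thesis
    using closed_walk_girth[OF simple girth, of ?ws] d(2) by simp
qed

text \<open>The two arcs have \<open>d\<close> and \<open>length vs - d\<close> edges. If
  \<open>xs\<close> is nonempty, \<open>detour_length\<close> applies to both, and adding the two
  bounds gives \<open>length vs \<le> 2 + 2 * length xs\<close>, at most 8. If \<open>xs\<close> is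
  empty, one of the arcs must be a single edge.\<close>

lemma no_detour:
  assumes xs: "distinct xs" "set xs \<inter> set vs = {}" "length xs \<le> 3"
    and walk: "successively (\<lambda>x y. {x, y} \<in> edges G) (cyc vs i # xs @ [cyc vs j])"
    and neq: "cyc vs i \<noteq> cyc vs j"
  shows "xs = [] \<and> (cyc vs j = cyc vs (i + 1) \<or> cyc vs j = cyc vs (i - 1))"
proof -
  let ?g = "int (length vs)"
  define d where "d = nat ((i - j) mod ?g)"
  have d: "int d = (i - j) mod ?g" using nonempty by (simp add: d_def)
  have "?g dvd i - (j + int d)" by (simp add: d mod_eq_dvd_iff[symmetric] mod_simps)
  then have i: "cyc vs i = cyc vs (j + int d)" by (simp add: cyc_eq)
  have d_less: "d < length vs" using d nonempty by (metis of_nat_less_iff pos_mod_bound length_greater_0_conv of_nat_0_less_iff)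
  have "d \<noteq> 0" using i neq by (metis add_0_right of_nat_0)
  have "?g dvd j - (i + int (length vs - d))"
  proof -
    have "j - (i + int (length vs - d)) = - (i - (j + int d)) - ?g" using d_less by simp
    then show ?thesis using \<open>?g dvd i - (j + int d)\<close> by (metis dvd_diff dvd_minus_iff dvd_refl)
  qed
  then have j: "cyc vs j = cyc vs (i + int (length vs - d))" by (simp add: cyc_eq)
  have walk': "successively (\<lambda>x y. {x, y} \<in> edges G) (cyc vs j # rev xs @ [cyc vs i])"
    using walk by (subst successively_rev[symmetric]) (simp add: insert_commute)
  have le1: "length vs \<le> Suc d + length xs" if "2 \<le> d + length xs"
    using detour_length[of xs j d] xs walk i d_less that by simp
  have le2: "length vs \<le> Suc (length vs - d) + length xs" if "2 \<le> length vs - d + length xs"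
    using detour_length[of "rev xs" i "length vs - d"] xs walk' j \<open>d \<noteq> 0\<close> nonempty that by simp
  have "xs = []"
  proof (rule ccontr)
    assume "xs \<noteq> []"
    then have "1 \<le> length xs" by (simp add: Suc_leI)
    then show False using le1 le2 \<open>d \<noteq> 0\<close> d_less xs(3) len by linarith
  qed
  moreover from this have "d = 1 \<or> length vs - d = 1"
    using le1 le2 \<open>d \<noteq> 0\<close> d_less len by simp linarith
  then have "cyc vs j = cyc vs (i + 1) \<or> cyc vs j = cyc vs (i - 1)"
    using i j by (auto simp: cyc_eq algebra_simps dvd_diff_commute)
  ultimately show ?thesis by blast
qed

lemma chord:
  assumes "{cyc vs i, cyc vs j} \<in> edges G"
  shows "cyc vs j = cyc vs (i + 1) \<or> cyc vs j = cyc vs (i - 1)"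
  using no_detour[of "[]" i j] assms edge_neq[OF simple assms] by simp

lemma foot:
  assumes "x \<notin> set vs" "{cyc vs i, x} \<in> edges G" "{cyc vs j, x} \<in> edges G"
  shows "cyc vs i = cyc vs j"
  using no_detour[of "[x]" i j] assms by (auto simp: insert_commute)

text \<open>Distinct feet are excluded by \<open>no_detour\<close>; a common foot would give a
  triangle. For \<open>no_cherry\<close> below, a common foot gives a cycle of length four.\<close>

lemma no_edge:
  assumes "x \<notin> set vs" "y \<notin> set vs" "{cyc vs i, x} \<in> edges G" "{cyc vs j, y} \<in> edges G"
  shows "{x, y} \<notin> edges G"
proof
  assume e: "{x, y} \<in> edges G"
  have xy: "x \<noteq> y" using edge_neq[OF simple e] .
  then have eq: "cyc vs i = cyc vs j" using no_detour[of "[x, y]" i j] assms e by (auto simp: insert_commute)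
  have "cyc vs i \<in> set vs" using range_cyc_vs by blast
  then show False
    using closed_walk_girth[OF simple girth, of "[cyc vs i, x, y]"] assms e eq xy len
    by (auto simp: insert_commute)
qed

lemma no_cherry:
  assumes "x \<notin> set vs" "y \<notin> set vs" "z \<notin> set vs" "{cyc vs i, x} \<in> edges G" "{cyc vs j, z} \<in> edges G"
    "{x, y} \<in> edges G" "{y, z} \<in> edges G"
  shows "x = z"
proof (rule ccontr)
  assume xz: "x \<noteq> z"
  have neq: "x \<noteq> y" "y \<noteq> z" using assms edge_neq[OF simple] by auto
  then have eq: "cyc vs i = cyc vs j"
    using no_detour[of "[x, y, z]" i j] assms xz by (auto simp: insert_commute)
  have "cyc vs i \<in> set vs" using range_cyc_vs by blast
  then show False
    using closed_walk_girth[OF simple girth, of "[cyc vs i, x, y, z]"] assms eq neq xz len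
    by (auto simp: insert_commute)
qed

text \<open>Deleting the closed neighbourhood of an induced matching that is maximal among those
  far from the cycle leaves only edges near the cycle.\<close>

lemma alternating_tails:
  assumes wim: "well_indumatched G" and "length vs \<noteq> 11"
  shows "even (length vs)"
    "\<exists>k. \<forall>i. even (i - k) \<longrightarrow> (\<exists>a b. a \<notin> set vs \<and> b \<notin> set vs \<and>
       {cyc vs i, a} \<in> edges G \<and> {a, b} \<in> edges G)"
proof -
  define far where "far e \<longleftrightarrow> (\<forall>i. apart G {cyc vs i} e)" for e
  let ?S = "{N. induced_matching G N \<and> (\<forall>e\<in>N. far e)}"
  have "finite ?S"
    by (rule finite_subset[of _ "Pow (edges G)"])
      (auto simp: induced_matching_iff finite_edges[OF simple])
  moreover have "{} \<in> ?S" by (simp add: induced_matching_def)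
  ultimately obtain N where N: "N \<in> ?S" and N_max: "\<forall>N'\<in>?S. N \<subseteq> N' \<longrightarrow> N = N'"
    using finite_has_maximal2[of ?S "{}"] by auto
  let ?H = "remaining G N"
  note H_edges = edges_remaining[OF simple, of N]
  have cyc_N: "apart G {cyc vs i} e" if "e \<in> N" for i e
    using N that by (auto simp: far_def)
  interpret H: hairy_cycle ?H "cyc vs" "int (length vs)"
  proof
    show "simple_graph ?H" using simple by (rule simple_remaining)
    show "well_indumatched ?H" using well_indumatched_remaining[OF simple wim] N by blast
    show "9 \<le> int (length vs)" using len by simp
    show "cyc vs i = cyc vs j \<longleftrightarrow> int (length vs) dvd i - j" for i j by (rule cyc_eq)
    show "{cyc vs i, cyc vs (i + 1)} \<in> edges ?H" for i
      using cyc_N[of _ i] cyc_N[of _ "i + 1"] ring[of i] by (auto simp: H_edges apart_def)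
    show "cyc vs j = cyc vs (i + 1) \<or> cyc vs j = cyc vs (i - 1)"
      if "{cyc vs i, cyc vs j} \<in> edges ?H" for i j
      using that chord by (simp add: H_edges)
    show "cyc vs i = cyc vs j"
      if "x \<notin> range (cyc vs)" "{cyc vs i, x} \<in> edges ?H" "{cyc vs j, x} \<in> edges ?H" for x i j
      using that foot by (simp add: H_edges range_cyc_vs)
    show "{x, y} \<notin> edges ?H"
      if "x \<notin> range (cyc vs)" "y \<notin> range (cyc vs)" "{cyc vs i, x} \<in> edges ?H" "{cyc vs j, y} \<in> edges ?H"
      for x y i j
      using that no_edge[of x y i j] by (simp add: H_edges range_cyc_vs)
    show "x = z"
      if "x \<notin> range (cyc vs)" "y \<notin> range (cyc vs)" "z \<notin> range (cyc vs)" "{cyc vs i, x} \<in> edges ?H"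
        "{cyc vs j, z} \<in> edges ?H" "{x, y} \<in> edges ?H" "{y, z} \<in> edges ?H" for x y z i j
      using that no_cherry[of x y z i j] by (simp add: H_edges range_cyc_vs)
    show "\<exists>x\<in>e. \<exists>i. x = cyc vs i \<or> {cyc vs i, x} \<in> edges ?H" if e: "e \<in> edges ?H" for e
    proof (rule ccontr)
      assume no: "\<not> ?thesis"
      have eG: "e \<in> edges G" "\<And>f. f \<in> N \<Longrightarrow> apart G e f" using e by (auto simp: H_edges)
      \<comment> \<open>An edge from the cycle to \<open>x\<close> would survive the deletion: its
        cycle end is apart from \<open>N\<close> because \<open>N\<close> is far, and
        \<open>x\<close> is because \<open>e\<close> survives. So \<open>e\<close> is far already in
        \<open>G\<close>, against the maximality of \<open>N\<close>.\<close>
      have "{cyc vs i, x} \<notin> edges G" if x: "x \<in> e" for x i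
      proof
        assume "{cyc vs i, x} \<in> edges G"
        moreover have "apart G {cyc vs i, x} f" if "f \<in> N" for f
          using cyc_N[OF that, of i] eG(2)[OF that] x by (auto simp: apart_def)
        ultimately have "{cyc vs i, x} \<in> edges ?H" by (simp add: H_edges)
        then show False using no x by blast
      qed
      then have "far e" using no by (auto simp: far_def apart_def)
      moreover have "induced_matching G ({e} \<union> N)"
        using N eG by (intro induced_matching_Un) (auto simp: induced_matching_iff)
      ultimately have "N = {e} \<union> N" using N N_max by auto
      then show False using eG not_apart_self[OF simple eG(1)] by blast
    qed
  qed
  have H11: "int (length vs) \<noteq> 11" using assms(2) by linarith
  show "even (length vs)" using H.tails_alternate(1)[OF H11] by simp
  show "\<exists>k. \<forall>i. even (i - k) \<longrightarrow> (\<exists>a b. a \<notin> set vs \<and> b \<notin> set vs \<and>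
       {cyc vs i, a} \<in> edges G \<and> {a, b} \<in> edges G)"
    using H.tails_alternate(2)[OF H11] unfolding H.tail_def range_cyc_vs H_edges by blast
qed

end

section \<open>Even cycles with alternating tails\<close>

text \<open>The classes of \<open>c\<close> are cliques in the conflict relation, so an induced
  matching has at most one edge per class. The edge \<open>t i\<close> conflicts only within its
  class, so maximality forces at least one.\<close>

lemma well_indumatched_partition:
  assumes simple: "simple_graph G"
    and c: "\<And>e. e \<in> edges G \<Longrightarrow> c e \<in> I"
    and t: "\<And>i. i \<in> I \<Longrightarrow> t i \<in> edges G" "\<And>i. i \<in> I \<Longrightarrow> c (t i) = i"
    and clique: "\<And>e f. e \<in> edges G \<Longrightarrow> f \<in> edges G \<Longrightarrow> c e = c f \<Longrightarrow> \<not> apart G e f"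
    and free: "\<And>e i. e \<in> edges G \<Longrightarrow> i \<in> I \<Longrightarrow> c e \<noteq> i \<Longrightarrow> apart G e (t i)"
  shows "well_indumatched G"
proof -
  have "card M = card I" if M: "maximal_induced_matching G M" for M
  proof -
    have ind: "M \<subseteq> edges G" "\<And>e f. e \<in> M \<Longrightarrow> f \<in> M \<Longrightarrow> e \<noteq> f \<Longrightarrow> apart G e f"
      using M by (simp_all add: maximal_induced_matching_def induced_matching_iff)
    have "inj_on c M" using ind clique unfolding inj_on_def by blast
    moreover have "c ` M = I"
    proof (intro equalityI subsetI)
      fix i assume i: "i \<in> I"
      show "i \<in> c ` M"
      proof (cases "t i \<in> M")
        case True
        then show ?thesis using t(2)[OF i] by force
      next
        case False
        then obtain e where "e \<in> M" "\<not> apart G (t i) e"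
          using maximal_induced_matching_blocks[OF M t(1)[OF i]] by blast
        then have "c e = i" using free[of e i] ind i apart_sym by blast
        then show ?thesis using \<open>e \<in> M\<close> by blast
      qed
    qed (use c ind in auto)
    ultimately show ?thesis by (metis card_image)
  qed
  then show ?thesis by (simp add: well_indumatched_def)
qed

text \<open>\<open>I\<close> holds the indices of the feet, and \<open>alternate\<close> forces even
  length. Length at least 5 matters for \<open>reduced\<close>: in a four-cycle the two vertices
  without tails have the same neighbours.\<close>

locale tailed_cycle =
  fixes G :: "'a ugraph" and vs :: "'a list" and I :: "nat set" and a b :: "nat \<Rightarrow> 'a"
  assumes dist: "distinct vs" and len: "5 \<le> length vs" and I_less: "i \<in> I \<Longrightarrow> i < length vs"
    and alternate: "i < length vs \<Longrightarrow> i \<in> I \<longleftrightarrow> Suc i mod length vs \<notin> I"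
    and inj_a: "inj_on a I" and inj_b: "inj_on b I"
    and a_b: "i \<in> I \<Longrightarrow> j \<in> I \<Longrightarrow> a i \<noteq> b j"
    and a_vs: "i \<in> I \<Longrightarrow> a i \<notin> set vs" and b_vs: "i \<in> I \<Longrightarrow> b i \<notin> set vs"
    and verts_G: "verts G = set vs \<union> a ` I \<union> b ` I"
    and edges_G: "edges G = edges (cycle_of vs) \<union> (\<lambda>i. {vs ! i, a i}) ` I \<union> (\<lambda>i. {a i, b i}) ` I"
begin

lemma nonempty: "vs \<noteq> []"
  using len by auto

lemma nth_I: "i \<in> I \<Longrightarrow> vs ! i \<in> set vs"
  using I_less by simp

lemma cycle_edge_verts:
  assumes "e \<in> edges (cycle_of vs)"
  shows "e \<subseteq> set vs"
  using assms nonempty range_cyc[OF nonempty] by (auto simp: edges_cycle_of)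

lemma simple: "simple_graph G"
proof -
  have "vs ! i \<noteq> a i" if "i \<in> I" for i
    using that a_vs I_less by (metis nth_mem)
  moreover have "finite I" using I_less by (meson finite_lessThan finite_subset lessThan_iff subsetI)
  moreover have "e \<subseteq> set vs \<and> card e = 2" if "e \<in> edges (cycle_of vs)" for e
    using that simple_cycle_of[OF dist] len by (auto simp: simple_graph_def)
  ultimately show ?thesis
    using a_b I_less by (auto simp: simple_graph_def verts_G edges_G)
qed

lemma b_edge: "i \<in> I \<Longrightarrow> {b i, y} \<in> edges G \<longleftrightarrow> y = a i"
  using cycle_edge_verts[of "{b i, y}"] b_vs[of i] a_b[of _ i, THEN not_sym] inj_onD[OF inj_b, of i] nth_I
  by (auto simp: edges_G doubleton_eq_iff)

lemma a_edge: "i \<in> I \<Longrightarrow> {a i, y} \<in> edges G \<longleftrightarrow> y = vs ! i \<or> y = b i"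
  using cycle_edge_verts[of "{a i, y}"] a_vs[of i] a_b[of i] I_less inj_onD[OF inj_a, of i]
  by (auto simp: edges_G doubleton_eq_iff)

lemma cycle_vertex_edge:
  assumes "x \<in> set vs"
  shows "{x, y} \<in> edges G \<longleftrightarrow> {x, y} \<in> edges (cycle_of vs) \<or> (\<exists>i\<in>I. x = vs ! i \<and> y = a i)"
  using assms a_vs b_vs by (auto simp: edges_G doubleton_eq_iff)

definition center :: "'a set \<Rightarrow> nat \<Rightarrow> bool" where
  "center e i \<longleftrightarrow> i \<in> I \<and> (vs ! i \<in> e \<or> a i \<in> e)"

text \<open>This assigns every edge to one tail. A cycle edge belongs to the tail at whichever of
  its ends is a foot, and \<open>alternate\<close> says that exactly one is.\<close>

lemma center_unique:
  assumes "e \<in> edges G"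
  shows "\<exists>!i. center e i"
proof -
  have nth_eq: "i = j" if "vs ! i = vs ! j" "i < length vs" "j < length vs" for i j
    using that dist by (simp add: nth_eq_iff_index_eq)
  consider i where "i < length vs" "e = {vs ! i, vs ! (Suc i mod length vs)}"
    | i where "i \<in> I" "e = {vs ! i, a i}" | i where "i \<in> I" "e = {a i, b i}"
    using assms unfolding edges_G cycle_of_def by auto
  then show ?thesis
  proof cases
    case 1
    let ?j = "Suc i mod length vs"
    have j: "?j < length vs" using nonempty by simp
    have c: "center e k \<longleftrightarrow> k \<in> I \<and> (k = i \<or> k = ?j)" for k
    proof -
      have "a k \<noteq> vs ! i" "a k \<noteq> vs ! ?j" if "k \<in> I"
        using that 1 j a_vs[of k] nth_mem by metis+
      then show ?thesis using 1 j nth_eq I_less by (auto simp: center_def)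
    qed
    show ?thesis using alternate[OF 1(1)] unfolding c by blast
  next
    case 2
    have "center e k \<longleftrightarrow> k = i" for k
    proof -
      have "vs ! k \<noteq> a i" "a k \<noteq> vs ! i" if "k \<in> I"
        using that 2 a_vs I_less nth_mem by metis+
      then show ?thesis using 2 nth_eq I_less inj_onD[OF inj_a] by (auto simp: center_def)
    qed
    then show ?thesis by simp
  next
    case 3
    have "center e k \<longleftrightarrow> k = i" for k
    proof -
      have "vs ! k \<noteq> a i" "vs ! k \<noteq> b i" if "k \<in> I"
        using that 3 a_vs b_vs I_less nth_mem by metis+
      then show ?thesis using 3 a_b inj_onD[OF inj_a] by (auto simp: center_def)
    qed
    then show ?thesis by simp
  qed
qed

text \<open>All edges meeting \<open>vs ! i\<close> or \<open>a i\<close> are in conflict with each other, and the edge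
  \<open>{a i, b i}\<close> is in conflict with no others; so a maximal induced matching contains exactly
  one edge for each \<open>i \<in> I\<close>.\<close>

lemma well_indumatched: "well_indumatched G"
proof (rule well_indumatched_partition[OF simple])
  let ?c = "\<lambda>e. THE i. center e i"
  have c: "center e (?c e)" if "e \<in> edges G" for e
    using center_unique[OF that] by (rule theI')
  show "?c e \<in> I" if "e \<in> edges G" for e using c[OF that] by (simp add: center_def)
  show t: "{a i, b i} \<in> edges G" if "i \<in> I" for i using that by (auto simp: edges_G)
  show "?c {a i, b i} = i" if "i \<in> I" for i
    using center_unique[OF t[OF that]] that by (intro the1_equality) (auto simp: center_def)
  show "\<not> apart G e f" if ef: "e \<in> edges G" "f \<in> edges G" "?c e = ?c f" for e f
  proof -
    obtain i where "center e i" "center f i" using c ef by metis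
    moreover from this have "{vs ! i, a i} \<in> edges G" by (auto simp: center_def edges_G)
    moreover from this have "{a i, vs ! i} \<in> edges G" by (simp add: insert_commute)
    ultimately show ?thesis unfolding center_def apart_def by blast
  qed
  show "apart G e {a i, b i}" if e: "e \<in> edges G" and i: "i \<in> I" "?c e \<noteq> i" for e i
  proof -
    have n: "vs ! i \<notin> e" "a i \<notin> e"
      using the1_equality[OF center_unique[OF e]] i by (auto simp: center_def)
    then have "b i \<notin> e"
      using edge_other_end[OF simple e, of "b i"] b_edge[OF i(1)] e by (metis insertI1 insert_commute)
    then show ?thesis
      using n a_edge[OF i(1)] b_edge[OF i(1)] by (auto simp: apart_def insert_commute)
  qed
qed

text \<open>The cyclic successor injects \<open>I\<close> into its complement and the complement
  into \<open>I\<close>, so \<open>I\<close> has half the indices; each contributes two edges beyond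
  the cycle.\<close>

lemma card_edges: "card (edges G) = 2 * length vs"
proof -
  have fin: "finite I" using I_less by (meson finite_lessThan finite_subset lessThan_iff subsetI)
  let ?s = "\<lambda>i. Suc i mod length vs" and ?J = "{..<length vs} - I"
  have inj_s: "inj_on ?s {..<length vs}"
    by (auto simp: inj_on_def mod_Suc split: if_splits)
  have s_less: "?s i < length vs" for i using nonempty by simp
  have "card I \<le> card ?J"
    using inj_s alternate I_less s_less
    by (intro card_inj_on_le[of ?s]) (auto intro: inj_on_subset)
  moreover have "card ?J \<le> card I"
    using inj_s alternate fin
    by (intro card_inj_on_le[of ?s]) (auto intro: inj_on_subset)
  moreover have "card ?J = length vs - card I" "card I \<le> length vs"
    using card_Diff_subset[OF fin, of "{..<length vs}"] card_mono[of "{..<length vs}" I] I_less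
    by auto
  ultimately have I: "2 * card I = length vs" by linarith
  let ?A = "(\<lambda>i. {vs ! i, a i}) ` I" and ?B = "(\<lambda>i. {a i, b i}) ` I"
  have A_ne: "vs ! i \<noteq> a j" "vs ! i \<noteq> b j" if "i \<in> I" "j \<in> I" for i j
    using that a_vs b_vs I_less nth_mem by metis+
  have "card ?A = card I"
    using A_ne inj_onD[OF inj_a] by (intro card_image inj_onI) (auto simp: doubleton_eq_iff)
  moreover have "card ?B = card I"
    using a_b inj_onD[OF inj_a] by (intro card_image inj_onI) (auto simp: doubleton_eq_iff)
  moreover have "?A \<inter> ?B = {}" using A_ne by (auto simp: doubleton_eq_iff)
  moreover have "edges (cycle_of vs) \<inter> (?A \<union> ?B) = {}"
    using cycle_edge_verts a_vs by blast
  moreover have "finite (edges (cycle_of vs))"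
    using finite_edges[OF simple_cycle_of[OF dist]] len by simp
  ultimately have "card (edges G) = card (edges (cycle_of vs)) + (card I + card I)"
    unfolding edges_G Un_assoc using fin by (simp add: card_Un_disjoint)
  then show ?thesis using I card_edges_cycle_of[OF dist] len by simp
qed

text \<open>Each vertex of a cycle has two neighbours on it. This rules out \<open>b i\<close>,
  which has degree one, and then \<open>a i\<close>, so only edges of \<open>cycle_of vs\<close>
  remain.\<close>

lemma cycles: "cycles G = {cycle_of vs}"
proof (intro equalityI subsetI)
  fix H assume "H \<in> cycles G"
  then obtain ws where ws: "distinct ws" "3 \<le> length ws" "H = cycle_of ws" and sub: "edges H \<subseteq> edges G"
    by (auto simp: cycles_def is_cycle_def subgraph_def)
  have ne: "ws \<noteq> []" using ws by auto
  have two_nbrs: "\<exists>y z. y \<noteq> z \<and> y \<in> set ws \<and> z \<in> set ws \<and> {x, y} \<in> edges G \<and> {x, z} \<in> edges G"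
    if x: "x \<in> set ws" for x
  proof -
    obtain j where j: "x = cyc ws j" using x by (rule in_set_cyc)
    have "cyc ws (j + 1) \<noteq> cyc ws (j - 1)"
      using not_dvd_small[of 2 "int (length ws)"] ws ne by (simp add: cyc_eq_iff)
    moreover have "{x, cyc ws (j + 1)} \<in> edges G" "{x, cyc ws (j - 1)} \<in> edges G"
      using cyc_edge[OF ne, of j] cyc_edge[OF ne, of "j - 1"] sub ws(3) j
      by (auto simp: insert_commute)
    ultimately show ?thesis using range_cyc[OF ne] by blast
  qed
  have b: "b i \<notin> set ws" if "i \<in> I" for i using two_nbrs[of "b i"] b_edge[OF that] by auto
  have a: "a i \<notin> set ws" if "i \<in> I" for i using two_nbrs[of "a i"] a_edge[OF that] b[OF that] by metis
  have "edges H \<subseteq> edges (cycle_of vs)"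
  proof
    fix e assume e: "e \<in> edges H"
    then have "e \<subseteq> set ws" using ws(3) range_cyc[OF ne] by (auto simp: edges_cycle_of[OF ne])
    then show "e \<in> edges (cycle_of vs)" using e sub a by (auto simp: edges_G)
  qed
  then show "H \<in> {cycle_of vs}"
    using cycle_of_subgraph_cycle_of[OF dist _ ws(1,2)] ws(3) len by simp
next
  fix H assume "H \<in> {cycle_of vs}"
  then show "H \<in> cycles G"
    using dist len simple_cycle_of[OF dist]
    by (auto simp: cycles_def is_cycle_def subgraph_def verts_G edges_G)
qed

lemma girth: "girth G = enat (length vs)"
  using card_edges_cycle_of[OF dist] len by (simp add: girth_def cycles)

lemma unique_cycle: "unique_cycle G = cycle_of vs"
  by (simp add: unique_cycle_def cycles)

lemma connected: "connected_graph G"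
proof -
  let ?r = "{(x, y). {x, y} \<in> edges G}"
  have sym: "sym (?r\<^sup>*)" by (intro sym_rtrancl) (auto simp: sym_def insert_commute)
  have v: "(cyc vs 0, cyc vs (int n)) \<in> ?r\<^sup>*" for n
  proof (induction n)
    case (Suc n)
    have "(cyc vs (int n), cyc vs (int (Suc n))) \<in> ?r"
      using cyc_edge[OF nonempty, of "int n"] by (simp add: edges_G add.commute)
    with Suc show ?case by (rule rtrancl_into_rtrancl)
  qed simp
  have nth: "(cyc vs 0, vs ! i) \<in> ?r\<^sup>*" if "i < length vs" for i
    using v[of i] that by (simp add: cyc_int)
  have a: "(cyc vs 0, a i) \<in> ?r\<^sup>*" if "i \<in> I" for i
    by (rule rtrancl_into_rtrancl[OF nth[OF I_less[OF that]]]) (use that in \<open>auto simp: edges_G\<close>)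
  have "(cyc vs 0, b i) \<in> ?r\<^sup>*" if "i \<in> I" for i
    by (rule rtrancl_into_rtrancl[OF a[OF that]]) (use that in \<open>auto simp: edges_G\<close>)
  with nth a have "(cyc vs 0, x) \<in> ?r\<^sup>*" if "x \<in> verts G" for x
    using that by (auto simp: verts_G in_set_conv_nth)
  then show ?thesis
    using symD[OF sym] rtrancl_trans[of _ _ ?r] nonempty
    unfolding connected_graph_def reachable_def by (metis Un_empty set_empty verts_G)
qed

lemma reduced: "reduced G"
proof -
  have nbhd_b: "nbhd G (b i) = {a i}" if "i \<in> I" for i
    using b_edge[OF that] by (auto simp: nbhd_def)
  have nbhd_a: "nbhd G (a i) = {vs ! i, b i}" if "i \<in> I" for i
    using a_edge[OF that] by (auto simp: nbhd_def)
  have cyc_mem: "cyc vs j \<in> set vs" for j using range_cyc[OF nonempty] by blast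
  have nbhd_v: "cyc vs (j + 1) \<in> nbhd G (cyc vs j)" "cyc vs (j - 1) \<in> nbhd G (cyc vs j)" for j
    using cyc_edge[OF nonempty, of j] cyc_edge[OF nonempty, of "j - 1"]
    by (auto simp: nbhd_def edges_G insert_commute)
  have nbhd_v': "x = cyc vs (j + 1) \<or> x = cyc vs (j - 1)" if "x \<in> nbhd G (cyc vs j)" "x \<in> set vs" for j x
    using that cycle_vertex_edge[OF cyc_mem, of j x] cyc_adjacent[OF dist nonempty, of j x] a_vs
    by (auto simp: nbhd_def)
  have v_v: "cyc vs j = cyc vs k" if eq: "nbhd G (cyc vs j) = nbhd G (cyc vs k)" for j k
  proof (rule ccontr)
    assume neq: "cyc vs j \<noteq> cyc vs k"
    let ?g = "int (length vs)"
    have "cyc vs (j + 1) = cyc vs (k + 1) \<or> cyc vs (j + 1) = cyc vs (k - 1)"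
      "cyc vs (j - 1) = cyc vs (k + 1) \<or> cyc vs (j - 1) = cyc vs (k - 1)"
      using nbhd_v[of j] nbhd_v' cyc_mem eq by auto
    \<comment> \<open>Distinct cycle vertices with equal neighbourhoods would exchange successor and
      predecessor, so the length would divide 4.\<close>
    then have "?g dvd (j + 1 - (k - 1))" "?g dvd (j - 1 - (k + 1))"
      using neq dist nonempty by (auto simp: cyc_eq_iff)
    then have "?g dvd (j + 1 - (k - 1)) - (j - 1 - (k + 1))" by (rule dvd_diff)
    then show False using not_dvd_small[of 4 ?g] len by simp
  qed
  have b_v: "b i \<notin> nbhd G (cyc vs j)" if "i \<in> I" for i j
    using b_edge[OF that, of "cyc vs j"] a_vs[OF that] cyc_mem[of j]
    by (auto simp: nbhd_def insert_commute)
  have v_b: "nbhd G (cyc vs j) \<noteq> nbhd G (b i)" if "i \<in> I" for i j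
    using nbhd_b[OF that] nbhd_v(1)[of j] cyc_mem[of "j + 1"] a_vs[OF that] by auto
  have a_b': "nbhd G (a i) \<noteq> nbhd G (b j)" if "i \<in> I" "j \<in> I" for i j
    using nbhd_a[OF that(1)] nbhd_b[OF that(2)] a_vs[OF that(2)] nth_I[OF that(1)] by auto
  have a_v: "nbhd G (a i) \<noteq> nbhd G (cyc vs j)" if "i \<in> I" for i j
    using nbhd_a[OF that] b_v[OF that, of j] by blast
  have a_a: "i = j" if "nbhd G (a i) = nbhd G (a j)" "i \<in> I" "j \<in> I" for i j
    using that nbhd_a b_vs I_less inj_onD[OF inj_b] by (metis insertCI insertE nth_mem singletonD)
  have b_b: "i = j" if "nbhd G (b i) = nbhd G (b j)" "i \<in> I" "j \<in> I" for i j
    using that nbhd_b inj_onD[OF inj_a] by auto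
  show ?thesis
    unfolding reduced_def
  proof (intro ballI impI notI)
    fix u w assume u: "u \<in> verts G" and w: "w \<in> verts G" and "u \<noteq> w" and eq: "nbhd G u = nbhd G w"
    have cases: "(\<exists>j. x = cyc vs j) \<or> (\<exists>i\<in>I. x = a i) \<or> (\<exists>i\<in>I. x = b i)" if "x \<in> verts G" for x
      using that range_cyc[OF nonempty] unfolding verts_G by blast
    show False
      using cases[OF u] cases[OF w] \<open>u \<noteq> w\<close> eq v_v v_b a_b' a_v a_a b_b by metis
  qed
qed

lemma edges_minus_cycle: "edges G - edges (cycle_of vs) = (\<lambda>i. {vs ! i, a i}) ` I \<union> (\<lambda>i. {a i, b i}) ` I"
  using cycle_edge_verts a_vs unfolding edges_G by blast

text \<open>Reduces computing a component to naming its vertex set: reachable from the root and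
  closed under edges off the cycle.\<close>

lemma cycle_tree_eq:
  assumes R: "vs ! i \<in> R" "R \<subseteq> verts G"
    and closed: "\<And>x y. x \<in> R \<Longrightarrow> {x, y} \<in> edges G - edges (cycle_of vs) \<Longrightarrow> y \<in> R"
    and reach: "\<And>x. x \<in> R \<Longrightarrow> (vs ! i, x) \<in> {(x, y). {x, y} \<in> edges G - edges (cycle_of vs)}\<^sup>*"
  shows "cycle_tree G (vs ! i) = \<lparr>verts = R, edges = {e \<in> edges G - edges (cycle_of vs). e \<subseteq> R}\<rparr>"
proof -
  have "reachable (delete_edges G (edges (cycle_of vs))) (vs ! i) x \<longleftrightarrow> x \<in> R" for x
  proof
    assume "reachable (delete_edges G (edges (cycle_of vs))) (vs ! i) x"
    then show "x \<in> R"
      unfolding reachable_def delete_edges_def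
      by (induction rule: rtrancl_induct) (use R(1) closed in auto)
  qed (use reach in \<open>simp add: reachable_def delete_edges_def\<close>)
  then show ?thesis
    using R by (auto simp: cycle_tree_def component_def unique_cycle delete_edges_def)
qed

lemma cycle_tree_in:
  assumes i: "i \<in> I"
  shows "type_ii (cycle_tree G (vs ! i)) (vs ! i)"
proof -
  let ?R = "{vs ! i, a i, b i}" and ?T = "edges G - edges (cycle_of vs)"
  have vi: "vs ! i \<in> set vs" using I_less[OF i] by simp
  have nth: "vs ! i = vs ! j \<longleftrightarrow> i = j" if "j \<in> I" for j
    using that i I_less dist by (simp add: nth_eq_iff_index_eq)
  have ne: "vs ! i \<noteq> a j" "vs ! i \<noteq> b j" if "j \<in> I" for j using that vi a_vs b_vs by auto
  have T: "{vs ! i, a i} \<in> ?T" "{a i, b i} \<in> ?T" using i by (auto simp: edges_minus_cycle)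
  have closed: "y \<in> ?R" if "x \<in> ?R" "{x, y} \<in> ?T" for x y
    using that a_edge[OF i] b_edge[OF i] cycle_vertex_edge[OF vi] nth by auto
  have reach: "(vs ! i, x) \<in> {(x, y). {x, y} \<in> ?T}\<^sup>*" if "x \<in> ?R" for x
  proof -
    have "(vs ! i, a i) \<in> {(x, y). {x, y} \<in> ?T}\<^sup>*" using T by auto
    moreover from this have "(vs ! i, b i) \<in> {(x, y). {x, y} \<in> ?T}\<^sup>*"
      by (rule rtrancl_into_rtrancl) (use T in auto)
    ultimately show ?thesis using that by auto
  qed
  have "{e \<in> ?T. e \<subseteq> ?R} = {{vs ! i, a i}, {a i, b i}}"
  proof (intro equalityI subsetI)
    fix e assume "e \<in> {e \<in> ?T. e \<subseteq> ?R}"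
    then obtain j where j: "j \<in> I" "e = {vs ! j, a j} \<or> e = {a j, b j}" "a j \<in> ?R"
      unfolding edges_minus_cycle by blast
    then have "a j = a i" using ne(1)[OF j(1)] a_b[OF j(1) i] by auto
    then have "j = i" using inj_onD[OF inj_a] j(1) i by blast
    then show "e \<in> {{vs ! i, a i}, {a i, b i}}" using j(2) by blast
  qed (use T in auto)
  moreover have "?R \<subseteq> verts G" using i vi by (auto simp: verts_G)
  ultimately have "cycle_tree G (vs ! i) = \<lparr>verts = ?R, edges = {{vs ! i, a i}, {a i, b i}}\<rparr>"
    using cycle_tree_eq[OF _ _ closed reach] by simp
  then show ?thesis
    unfolding type_ii_def using ne[OF i] a_b[OF i i] by (intro exI[of _ "a i"] exI[of _ "b i"]) auto
qed

lemma cycle_tree_notin: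
  assumes i: "i < length vs" "i \<notin> I"
  shows "type_i (cycle_tree G (vs ! i)) (vs ! i)"
proof -
  let ?T = "edges G - edges (cycle_of vs)"
  have "vs ! i \<noteq> vs ! j" "vs ! i \<noteq> a j" "vs ! i \<noteq> b j" if "j \<in> I" for j
    using that i a_vs b_vs I_less dist by (auto simp: nth_eq_iff_index_eq) (metis nth_mem)+
  then have T: "vs ! i \<notin> e" if "e \<in> ?T" for e
    using that unfolding edges_minus_cycle by auto
  have "False" if "e \<in> ?T" "e \<subseteq> {vs ! i}" for e
  proof -
    have "e = {}" using T[OF that(1)] that(2) by blast
    then show False using that(1) simple by (auto simp: simple_graph_def)
  qed
  then have "{e \<in> ?T. e \<subseteq> {vs ! i}} = {}" by blast
  moreover have "cycle_tree G (vs ! i) = \<lparr>verts = {vs ! i}, edges = {e \<in> ?T. e \<subseteq> {vs ! i}}\<rparr>"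
    using i T by (intro cycle_tree_eq) (auto simp: verts_G)
  ultimately show ?thesis by (simp add: type_i_def)
qed

lemma type_ii_iff: "i < length vs \<Longrightarrow> type_ii (cycle_tree G (vs ! i)) (vs ! i) \<longleftrightarrow> i \<in> I"
  using cycle_tree_in[of i] cycle_tree_notin[of i]
  by (cases "i \<in> I") (auto simp: type_i_def type_ii_def)

end

section \<open>From shortest cycles to subgraphs with alternating tails\<close>

text \<open>The tails are chosen independently, so their disjointness has to be shown:
  \<open>foot\<close> separates the \<open>a i\<close>, \<open>no_cherry\<close> the
  \<open>b i\<close>, and \<open>no_edge\<close> the \<open>a i\<close> from the
  \<open>b j\<close>.\<close>

lemma (in shortest_cycle) tailed_subgraph:
  assumes wim: "well_indumatched G" and "length vs \<noteq> 11"
  shows "\<exists>K I a b. subgraph K G \<and> tailed_cycle K vs I a b"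
proof -
  note even = alternating_tails(1)[OF assms]
  obtain k where k: "\<And>i. even (i - k) \<Longrightarrow> \<exists>a b. a \<notin> set vs \<and> b \<notin> set vs \<and>
       {cyc vs i, a} \<in> edges G \<and> {a, b} \<in> edges G"
    using alternating_tails(2)[OF assms] by blast
  define I where "I = {i. i < length vs \<and> even (int i - k)}"
  have "\<exists>p. fst p \<notin> set vs \<and> snd p \<notin> set vs \<and> {vs ! i, fst p} \<in> edges G \<and> {fst p, snd p} \<in> edges G"
    if "i \<in> I" for i
    using k[of "int i"] that by (auto simp: I_def cyc_int)
  then obtain p where p: "\<And>i. i \<in> I \<Longrightarrow> fst (p i) \<notin> set vs \<and> snd (p i) \<notin> set vs \<and>
      {vs ! i, fst (p i)} \<in> edges G \<and> {fst (p i), snd (p i)} \<in> edges G"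
    by metis
  define a b where "a = fst \<circ> p" and "b = snd \<circ> p"
  have I_less: "i < length vs" if "i \<in> I" for i using that by (simp add: I_def)
  have ab: "a i \<notin> set vs" "b i \<notin> set vs" "{vs ! i, a i} \<in> edges G" "{a i, b i} \<in> edges G" if "i \<in> I" for i
    using p[OF that] by (simp_all add: a_def b_def)
  have va: "{cyc vs (int i), a i} \<in> edges G" if "i \<in> I" for i
    using ab(3)[OF that] I_less[OF that] by (simp add: cyc_int)
  have inj_a: "i = j" if "i \<in> I" "j \<in> I" "a i = a j" for i j
  proof -
    have "cyc vs (int i) = cyc vs (int j)" using foot[of "a i"] ab(1) va that by metis
    then show ?thesis using that I_less dist by (simp add: cyc_int nth_eq_iff_index_eq)
  qed
  define K where "K = \<lparr>verts = set vs \<union> a ` I \<union> b ` I,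
    edges = edges (cycle_of vs) \<union> (\<lambda>i. {vs ! i, a i}) ` I \<union> (\<lambda>i. {a i, b i}) ` I\<rparr>"
  have tc: "tailed_cycle K vs I a b"
  proof
    show "distinct vs" by (rule dist)
    show "5 \<le> length vs" using len by simp
    show "i \<in> I \<longleftrightarrow> Suc i mod length vs \<notin> I" if "i < length vs" for i
    proof (cases "Suc i = length vs")
      case True
      \<comment> \<open>At the wrap-around from the last index to 0, parity alternates because the
        length is even.\<close>
      then have "odd i" using even by (metis even_Suc)
      then show ?thesis using True that by (auto simp: I_def)
    qed (use that in \<open>auto simp: I_def\<close>)
    show "inj_on a I" using inj_a by (auto intro: inj_onI)
    show "inj_on b I"
    proof
      fix i j assume ij: "i \<in> I" "j \<in> I" "b i = b j"
      then have "a i = a j"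
        using no_cherry[of "a i" "b i" "a j" "int i" "int j"] ab[of i] ab[of j] va
        by (auto simp: insert_commute)
      then show "i = j" using inj_a ij by blast
    qed
    show "a i \<noteq> b j" if "i \<in> I" "j \<in> I" for i j
      using no_edge[of "a j" "a i" "int j" "int i"] ab[of i] ab[of j] va that by auto
  qed (use I_less ab in \<open>auto simp: K_def\<close>)
  have "subgraph K G"
  proof -
    have "edges (cycle_of vs) \<subseteq> edges G" "set vs \<subseteq> verts G"
      using cycle by (auto simp: cycles_def subgraph_def)
    moreover have "a i \<in> verts G" "b i \<in> verts G" if "i \<in> I" for i
      using ab(4)[OF that] edge_verts[OF simple] by auto
    ultimately show ?thesis
      using tailed_cycle.simple[OF tc] ab by (auto simp: subgraph_def K_def)
  qed
  with tc show ?thesis by blast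
qed

text \<open>Without isolated vertices, a subgraph with all edges is the whole graph; the minimality
  argument needs this.\<close>

lemma (in tailed_cycle) verts_subset_Union_edges: "verts G \<subseteq> \<Union> (edges G)"
proof
  fix x assume "x \<in> verts G"
  then consider i where "x = cyc vs i" | i where "i \<in> I" "x = a i \<or> x = b i"
    using range_cyc[OF nonempty] unfolding verts_G by blast
  then show "x \<in> \<Union> (edges G)"
  proof cases
    case 1
    then show ?thesis using cyc_edge[OF nonempty, of i] by (auto simp: edges_G)
  qed (auto simp: edges_G)
qed

section \<open>Reading off the tails of a unicyclic graph from its components\<close>

lemma reachable_sym: "reachable G x y \<Longrightarrow> reachable G y x"
proof -
  have "sym {(x, y). {x, y} \<in> edges G}" by (auto simp: sym_def insert_commute)
  then show "reachable G x y \<Longrightarrow> reachable G y x"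
    unfolding reachable_def by (meson sym_rtrancl symD)
qed

lemma reachable_trans: "reachable G x y \<Longrightarrow> reachable G y z \<Longrightarrow> reachable G x z"
  unfolding reachable_def by (rule rtrancl_trans)

lemma reachable_edge: "{x, y} \<in> edges G \<Longrightarrow> reachable G x y"
  unfolding reachable_def by auto

lemma component_eq: "reachable G x y \<Longrightarrow> component G x = component G y"
  unfolding component_def by (auto intro: reachable_trans reachable_sym)

text \<open>The only cycle is a shortest one, which makes \<open>foot\<close> available. The type
  conditions do not themselves say that a tree meets the cycle only at its root; \<open>a_vs\<close>
  and \<open>b_vs\<close> supply this.\<close>

lemma unicyclic_tailed_cycle:
  assumes simple: "simple_graph G" and uni: "unicyclic G" and dist: "distinct vs" and len: "10 \<le> length vs"
    and uc: "unique_cycle G = cycle_of vs"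
    and types: "\<And>i. i < length vs \<Longrightarrow>
      type_i (cycle_tree G (vs ! i)) (vs ! i) \<or> type_ii (cycle_tree G (vs ! i)) (vs ! i)"
    and alternate: "\<And>i. i < length vs \<Longrightarrow> type_ii (cycle_tree G (vs ! i)) (vs ! i) \<noteq>
      type_ii (cycle_tree G (vs ! (Suc i mod length vs))) (vs ! (Suc i mod length vs))"
  shows "\<exists>I a b. tailed_cycle G vs I a b"
proof -
  have ne: "vs \<noteq> []" using len by auto
  have ex1: "\<exists>!H. H \<in> cycles G" using uni by (simp add: unicyclic_def)
  have "cycle_of vs \<in> cycles G"
    using theI'[OF ex1] uc by (simp add: unique_cycle_def)
  then have cycles: "cycles G = {cycle_of vs}" using ex1 by blast
  then have "girth G = enat (length vs)"
    using card_edges_cycle_of[OF dist] len by (simp add: girth_def)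
  then interpret S: shortest_cycle G vs
    using simple dist len cycles by unfold_locales auto
  let ?C = "edges (cycle_of vs)"
  define F where "F = delete_edges G ?C"
  have F: "verts F = verts G" "edges F = edges G - ?C" by (simp_all add: F_def delete_edges_def)
  have tree: "cycle_tree G v = component F v" for v by (simp add: cycle_tree_def uc F_def)
  define I where "I = {i. i < length vs \<and> type_ii (component F (vs ! i)) (vs ! i)}"
  have "\<exists>p. distinct [vs ! i, fst p, snd p] \<and> component F (vs ! i) =
      \<lparr>verts = {vs ! i, fst p, snd p}, edges = {{vs ! i, fst p}, {fst p, snd p}}\<rparr>" if "i \<in> I" for i
    using that by (auto simp: I_def type_ii_def)
  then obtain p where p: "\<And>i. i \<in> I \<Longrightarrow> distinct [vs ! i, fst (p i), snd (p i)] \<and> component F (vs ! i) =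
      \<lparr>verts = {vs ! i, fst (p i), snd (p i)}, edges = {{vs ! i, fst (p i)}, {fst (p i), snd (p i)}}\<rparr>"
    by metis
  define a b where "a = fst \<circ> p" and "b = snd \<circ> p"
  have ab: "distinct [vs ! i, a i, b i]"
    "component F (vs ! i) = \<lparr>verts = {vs ! i, a i, b i}, edges = {{vs ! i, a i}, {a i, b i}}\<rparr>"
    if "i \<in> I" for i
    using p[OF that] by (simp_all add: a_def b_def)
  have notin: "component F (vs ! i) = \<lparr>verts = {vs ! i}, edges = {}\<rparr>" if "i < length vs" "i \<notin> I" for i
    using types[OF that(1)] that by (auto simp: tree I_def type_i_def)
  have I_less: "i < length vs" if "i \<in> I" for i using that by (simp add: I_def)
  have vs_G: "set vs \<subseteq> verts G" and C_G: "?C \<subseteq> edges G"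
    using S.cycle by (auto simp: cycles_def subgraph_def)
  have in_comp: "x \<in> verts (component F v) \<longleftrightarrow> x \<in> verts G \<and> reachable F v x" for x v
    by (simp add: component_def F)
  have F_edges: "{vs ! i, a i} \<in> edges F" "{a i, b i} \<in> edges F" if "i \<in> I" for i
  proof -
    have "edges (component F (vs ! i)) \<subseteq> edges F" by (auto simp: component_def)
    then show "{vs ! i, a i} \<in> edges F" "{a i, b i} \<in> edges F" by (simp_all add: ab(2)[OF that])
  qed
  \<comment> \<open>If \<open>a i\<close> were the cycle vertex \<open>vs ! j\<close>, the trees at
    \<open>i\<close> and \<open>j\<close> would coincide. Both edges of the first contain
    \<open>a i\<close>, but the outer edge \<open>{a j, b j}\<close> of the second avoids its
    root.\<close>
  have a_vs: "a i \<notin> set vs" if i: "i \<in> I" for i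
  proof
    assume "a i \<in> set vs"
    then obtain j where j: "j < length vs" "a i = vs ! j" by (metis in_set_conv_nth)
    have eq: "component F (vs ! i) = component F (vs ! j)"
      using component_eq[OF reachable_edge[OF F_edges(1)[OF i]]] j by simp
    have "j \<in> I" using eq ab[OF i] notin[OF j(1)] by (cases "j \<in> I") auto
    have "{a j, b j} \<in> edges (component F (vs ! j))" using ab(2)[OF \<open>j \<in> I\<close>] by simp
    then have "{a j, b j} \<in> {{vs ! i, a i}, {a i, b i}}" using ab(2)[OF i] eq by simp
    then have "a i \<in> {a j, b j}" by (elim insertE) simp_all
    then show False using ab(1)[OF \<open>j \<in> I\<close>] j(2) by simp
  qed
  \<comment> \<open>Otherwise \<open>a i\<close> would be an outer vertex with the two distinct
    cycle neighbours \<open>vs ! i\<close> and \<open>b i\<close>.\<close>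
  have b_vs: "b i \<notin> set vs" if i: "i \<in> I" for i
  proof
    assume "b i \<in> set vs"
    then obtain j where j: "b i = cyc vs j" by (rule in_set_cyc)
    have "cyc vs (int i) = cyc vs j"
      using S.foot[of "a i" "int i" j] a_vs[OF i] F_edges[OF i] I_less[OF i] j
      by (simp add: F cyc_int insert_commute)
    then show False using ab(1)[OF i] I_less[OF i] j by (simp add: cyc_int)
  qed
  have disjoint: "i = j" if ij: "i \<in> I" "j \<in> I" and "x \<in> {vs ! i, a i, b i}" "x \<in> {vs ! j, a j, b j}" for i j x
  proof -
    have "reachable F (vs ! i) x" "reachable F (vs ! j) x"
      using that in_comp[of x "vs ! i"] in_comp[of x "vs ! j"] ab(2) by auto
    then have "reachable F (vs ! i) (vs ! j)" by (meson reachable_sym reachable_trans)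
    then have "vs ! j \<in> verts (component F (vs ! i))"
      using in_comp vs_G I_less[OF ij(2)] by auto
    moreover have "vs ! j \<noteq> a i" "vs ! j \<noteq> b i"
      using a_vs[OF ij(1)] b_vs[OF ij(1)] nth_mem[OF I_less[OF ij(2)]] by metis+
    ultimately have "vs ! j = vs ! i" using ab(2)[OF ij(1)] by simp
    then show ?thesis using I_less ij dist by (simp add: nth_eq_iff_index_eq)
  qed
  have cover: "\<exists>i<length vs. reachable F (vs ! i) u" if "u \<in> verts G" for u
  proof -
    have "(vs ! 0, u) \<in> {(x, y). {x, y} \<in> edges G}\<^sup>*"
      using uni that vs_G ne by (auto simp: unicyclic_def connected_graph_def reachable_def subset_iff)
    then show ?thesis
    proof (induction rule: rtrancl_induct)
      case base
      then show ?case using ne by (intro exI[of _ 0]) (auto simp: reachable_def)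
    next
      case (step y z)
      show ?case
      \<comment> \<open>Follow a walk in \<open>G\<close>: a cycle edge ends on the cycle, where
        \<open>z\<close> becomes the new root; any other edge stays in the component.\<close>
      proof (cases "{y, z} \<in> ?C")
        case True
        then have "z \<in> set vs" using simple_cycle_of[OF dist] len by (auto simp: simple_graph_def)
        then show ?thesis by (metis in_set_conv_nth reachable_def rtrancl.rtrancl_refl)
      next
        case False
        then have "reachable F y z" using step by (intro reachable_edge) (auto simp: F)
        then show ?thesis using step.IH reachable_trans by metis
      qed
    qed
  qed
  have edges_F: "edges F = (\<lambda>i. {vs ! i, a i}) ` I \<union> (\<lambda>i. {a i, b i}) ` I"
  proof (intro equalityI subsetI)
    fix e assume e: "e \<in> edges F"
    then have "e \<in> edges G" by (simp add: F)
    then obtain x y where xy: "e = {x, y}" "x \<in> verts G"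
      using edge_cases[OF simple] by metis
    then obtain i where i: "i < length vs" "reachable F (vs ! i) x" using cover by blast
    then have "reachable F (vs ! i) y"
      using e xy reachable_edge reachable_trans by metis
    then have "e \<in> edges (component F (vs ! i))" using e xy i by (simp add: component_def)
    then show "e \<in> (\<lambda>i. {vs ! i, a i}) ` I \<union> (\<lambda>i. {a i, b i}) ` I"
      using ab(2)[of i] notin[OF i(1)] by (cases "i \<in> I") auto
  qed (use F_edges in auto)
  have "tailed_cycle G vs I a b"
  proof
    show "distinct vs" by (rule dist)
    show "5 \<le> length vs" using len by simp
    show "i \<in> I \<longleftrightarrow> Suc i mod length vs \<notin> I" if "i < length vs" for i
      using alternate[OF that] that ne by (simp add: I_def tree)
    show "inj_on a I" "inj_on b I" using disjoint by (auto intro!: inj_onI)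
    show "a i \<noteq> b j" if "i \<in> I" "j \<in> I" for i j
      using disjoint[OF that, of "a i"] ab(1)[OF that(1)] by auto
    show "verts G = set vs \<union> a ` I \<union> b ` I"
    proof (intro equalityI subsetI)
      fix u assume u: "u \<in> verts G"
      then obtain i where i: "i < length vs" "reachable F (vs ! i) u" using cover by blast
      then have "u \<in> verts (component F (vs ! i))" using in_comp u by blast
      then show "u \<in> set vs \<union> a ` I \<union> b ` I"
        using ab(2)[of i] notin[OF i(1)] i(1) by (cases "i \<in> I") auto
    next
      fix u assume "u \<in> set vs \<union> a ` I \<union> b ` I"
      then show "u \<in> verts G"
        using vs_G F_edges F edge_verts[OF simple] by blast
    qed
    show "edges G = ?C \<union> (\<lambda>i. {vs ! i, a i}) ` I \<union> (\<lambda>i. {a i, b i}) ` I"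
      using edges_F C_G unfolding F by blast
  qed (use I_less a_vs b_vs in auto)
  then show ?thesis by blast
qed

section \<open>The cycle of length eleven\<close>

text \<open>By maximality the windows of five edges centred at the chosen ones cover all 11 edges,
  so at least three are chosen. The windows of three that start at the chosen ones are disjoint,
  since an overlap means an index difference of at most 2 modulo 11, a conflict; so at most three
  are chosen.\<close>

lemma well_indumatched_cycle_11:
  assumes dist: "distinct vs" and len: "length vs = 11"
  shows "well_indumatched (cycle_of vs)"
proof -
  let ?G = "cycle_of vs"
  have ne: "vs \<noteq> []" using len by auto
  define E where "E i = {cyc vs i, cyc vs (i + 1)}" for i
  have eq: "cyc vs i = cyc vs j \<longleftrightarrow> 11 dvd i - j" for i j
    using cyc_eq_iff[OF dist ne] len by simp
  have adj: "{cyc vs i, cyc vs j} \<in> edges ?G \<longleftrightarrow> 11 dvd i - j + 1 \<or> 11 dvd i - j - 1" for i j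
  proof
    assume "{cyc vs i, cyc vs j} \<in> edges ?G"
    then have "11 dvd j - (i + 1) \<or> 11 dvd j - (i - 1)"
      using cyc_adjacent[OF dist ne] eq by blast
    then show "11 dvd i - j + 1 \<or> 11 dvd i - j - 1" by presburger
  next
    assume "11 dvd i - j + 1 \<or> 11 dvd i - j - 1"
    then have "cyc vs j = cyc vs (i + 1) \<or> cyc vs i = cyc vs (j + 1)" unfolding eq by presburger
    then show "{cyc vs i, cyc vs j} \<in> edges ?G"
      using cyc_edge[OF ne, of i] cyc_edge[OF ne, of j] by (auto simp: insert_commute)
  qed
  have apart: "apart ?G (E i) (E j) \<longleftrightarrow> (\<forall>d\<in>{-2..2}. \<not> 11 dvd i - j + d)" for i j
  proof -
    have "{-2..2} = {-2, -1, 0, 1, 2::int}" by auto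
    then show ?thesis
      by (simp add: apart_def E_def eq adj) presburger
  qed
  have inj: "inj_on E {0..<11}"
  proof
    fix i j :: int assume ij: "i \<in> {0..<11}" "j \<in> {0..<11}" "E i = E j"
    then have "11 dvd i - j \<or> 11 dvd i - (j + 1) \<and> 11 dvd i + 1 - j"
      by (auto simp: E_def doubleton_eq_iff eq)
    then show "i = j" using ij(1,2) by simp presburger
  qed
  have edges: "edges ?G = E ` {0..<11}"
  proof -
    have "E i = E (i mod 11)" for i
      by (simp add: E_def doubleton_eq_iff eq mod_eq_dvd_iff[symmetric] mod_simps)
    moreover have "edges ?G = range E" by (auto simp: edges_cycle_of[OF ne] E_def)
    ultimately show ?thesis by (auto simp: image_iff) (metis atLeastLessThan_iff pos_mod_bound pos_mod_sign zero_less_numeral)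
  qed
  have "card M = 3" if M: "maximal_induced_matching ?G M" for M
  proof -
    define J where "J = {j \<in> {0..<11}. E j \<in> M}"
    have ind: "M \<subseteq> edges ?G" "\<And>e f. e \<in> M \<Longrightarrow> f \<in> M \<Longrightarrow> e \<noteq> f \<Longrightarrow> apart ?G e f"
      using M by (simp_all add: maximal_induced_matching_def induced_matching_iff)
    have J: "J \<subseteq> {0..<11}" by (auto simp: J_def)
    then have finJ: "finite J" by (rule finite_subset) simp
    have "M = E ` J" using ind(1) edges by (auto simp: J_def)
    then have card: "card M = card J" using inj J by (metis card_image inj_on_subset)
    let ?B = "\<lambda>D j. (\<lambda>d. (j + d) mod 11) ` D"
    have "{0..<11} \<subseteq> (\<Union>j\<in>J. ?B {-2..2} j)"
    proof
      fix i :: int assume i: "i \<in> {0..<11}"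
      have "\<exists>j\<in>J. \<exists>d\<in>{-2..2}. 11 dvd i - j + d"
      proof (cases "E i \<in> M")
        case True
        then show ?thesis using i by (intro bexI[of _ i] bexI[of _ 0]) (auto simp: J_def)
      next
        case False
        then obtain e where "e \<in> M" "\<not> apart ?G (E i) e"
          using maximal_induced_matching_blocks[OF M, of "E i"] i edges by blast
        then show ?thesis using \<open>M = E ` J\<close> apart by auto
      qed
      then obtain j d where j: "j \<in> J" "d \<in> {-2..2}" "11 dvd i - j + d" by blast
      then have "i mod 11 = (j + (- d)) mod 11" by (simp add: mod_eq_dvd_iff algebra_simps)
      then have "i = (j + (- d)) mod 11" using i by simp
      moreover have "- d \<in> {-2..2}" using j by auto
      ultimately show "i \<in> (\<Union>j\<in>J. ?B {-2..2} j)" using j(1) by blast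
    qed
    then have "card {0..<11::int} \<le> card (\<Union>j\<in>J. ?B {-2..2} j)"
      using finJ by (intro card_mono) auto
    also have "\<dots> \<le> (\<Sum>j\<in>J. card (?B {-2..2} j))" using finJ by (intro card_UN_le)
    also have "\<dots> \<le> (\<Sum>j\<in>J. 5)"
      by (intro sum_mono order_trans[OF card_image_le]) auto
    finally have lower: "11 \<le> card J * 5" by simp
    have "(\<Sum>j\<in>J. 3) = (\<Sum>j\<in>J. card (?B {0..2} j))"
    proof (rule sum.cong)
      fix j :: int
      have "inj_on (\<lambda>d. (j + d) mod 11) {0..2}"
      proof
        fix d d' assume "d \<in> {0..2}" "d' \<in> {0..2}" "(j + d) mod 11 = (j + d') mod 11"
        then have "11 dvd d - d'" "0 \<le> d" "d \<le> 2" "0 \<le> d'" "d' \<le> 2"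
          by (auto simp: mod_eq_dvd_iff)
        then show "d = d'" by presburger
      qed
      then show "3 = card (?B {0..2} j)" by (simp add: card_image)
    qed simp
    also have "\<dots> = card (\<Union>j\<in>J. ?B {0..2} j)"
    proof (rule card_UN_disjoint[symmetric])
      show "\<forall>i\<in>J. \<forall>j\<in>J. i \<noteq> j \<longrightarrow> ?B {0..2} i \<inter> ?B {0..2} j = {}"
      proof (intro ballI impI equals0I)
        fix i j x assume ij: "i \<in> J" "j \<in> J" "i \<noteq> j" and "x \<in> ?B {0..2} i \<inter> ?B {0..2} j"
        then obtain d d' where d: "d \<in> {0..2}" "d' \<in> {0..2}" "(i + d) mod 11 = (j + d') mod 11" by auto
        have "E i \<noteq> E j" using ij inj J by (meson inj_onD subsetD)
        then have "apart ?G (E i) (E j)" using ij ind(2) by (simp add: J_def)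
        moreover have "11 dvd i - j + (d - d')" using d(3) by (simp add: mod_eq_dvd_iff algebra_simps)
        moreover have "d - d' \<in> {-2..2}" using d by auto
        ultimately show False using apart by blast
      qed
    qed (use finJ in auto)
    also have "\<dots> \<le> card {0..<11::int}" by (intro card_mono) auto
    finally have "3 * card J \<le> 11" by simp
    with lower card show ?thesis by linarith
  qed
  then show ?thesis by (simp add: well_indumatched_def)
qed

section \<open>Isomorphism with the standard cycle\<close>

lemma edges_cycle_of_image:
  "edges (cycle_of vs) = (\<lambda>i. {vs ! i, vs ! (Suc i mod length vs)}) ` {..<length vs}"
  by (auto simp: cycle_of_def)

lemma edges_cycle_of_map: "edges (cycle_of (map h xs)) = (`) h ` edges (cycle_of xs)"
proof -
  have "{map h xs ! i, map h xs ! (Suc i mod length xs)} = h ` {xs ! i, xs ! (Suc i mod length xs)}"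
    if "i < length xs" for i
    using that by (subst (1 2) nth_map) (auto intro: mod_less_divisor)
  then have "(\<lambda>i. {map h xs ! i, map h xs ! (Suc i mod length xs)}) ` {..<length xs} =
      (`) h ` (\<lambda>i. {xs ! i, xs ! (Suc i mod length xs)}) ` {..<length xs}"
    unfolding image_image by (intro image_cong) auto
  then show ?thesis
    by (simp add: edges_cycle_of_image)
qed

text \<open>Mapping \<open>[0..<n]\<close> by the inverse of an isomorphism lists the vertices of
  \<open>G\<close> in cyclic order; conversely \<open>(!) vs\<close> is the inverse of an
  isomorphism.\<close>

lemma isomorphic_cycle_graph_iff:
  assumes simple: "simple_graph G" and n: "3 \<le> n"
  shows "isomorphic G (cycle_graph n) \<longleftrightarrow> (\<exists>vs. distinct vs \<and> length vs = n \<and> G = cycle_of vs)"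
proof -
  have C: "simple_graph (cycle_graph n)" "verts (cycle_graph n) = {0..<n}"
    using simple_cycle_of[of "[0..<n]"] n by (simp_all add: cycle_graph_def)
  have "\<exists>vs. distinct vs \<and> length vs = n \<and> G = cycle_of vs" if iso: "isomorphic G (cycle_graph n)"
  proof -
    from iso obtain f where f: "bij_betw f (verts G) {0..<n}"
      "\<And>u v. u \<in> verts G \<Longrightarrow> v \<in> verts G \<Longrightarrow> {u, v} \<in> edges G \<longleftrightarrow> {f u, f v} \<in> edges (cycle_graph n)"
      unfolding isomorphic_def C(2) by blast
    define h where "h = inv_into (verts G) f"
    have h: "bij_betw h {0..<n} (verts G)" using f(1) by (simp add: h_def bij_betw_inv_into)
    have hf: "h (f x) = x" if "x \<in> verts G" for x
      using that f(1) by (simp add: h_def bij_betw_inv_into_left)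
    have fh: "f (h i) = i" if "i \<in> {0..<n}" for i
      using that f(1) by (simp add: h_def bij_betw_inv_into_right)
    have hV: "h i \<in> verts G" if "i \<in> {0..<n}" for i using that h by (auto simp: bij_betw_def)
    let ?vs = "map h [0..<n]"
    have "edges (cycle_of ?vs) = edges G"
    proof (intro equalityI subsetI)
      fix e assume "e \<in> edges (cycle_of ?vs)"
      then obtain e' where e': "e' \<in> edges (cycle_graph n)" "e = h ` e'"
        by (auto simp: edges_cycle_of_map cycle_graph_def)
      then obtain x y where "e' = {x, y}" "x \<in> {0..<n}" "y \<in> {0..<n}"
        using edge_cases[OF C(1) e'(1)] C(2) by metis
      then show "e \<in> edges G" using e' f(2)[OF hV hV] fh by simp
    next
      fix e assume e: "e \<in> edges G"
      then obtain x y where xy: "e = {x, y}" "x \<in> verts G" "y \<in> verts G"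
        using edge_cases[OF simple e] by metis
      then have "{f x, f y} \<in> edges (cycle_graph n)" using e f(2) by blast
      moreover have "e = h ` {f x, f y}" using xy hf by simp
      ultimately show "e \<in> edges (cycle_of ?vs)"
        unfolding edges_cycle_of_map cycle_graph_def by blast
    qed
    moreover have "set ?vs = verts G" using h by (simp add: bij_betw_def)
    ultimately have "G = cycle_of ?vs" by (intro ugraph.equality) simp_all
    moreover have "distinct ?vs" using h by (simp add: distinct_map bij_betw_def)
    ultimately show ?thesis
      by (intro exI[of _ ?vs]) simp
  qed
  moreover have "isomorphic G (cycle_graph n)"
    if vs: "distinct vs" "length vs = n" "G = cycle_of vs" for vs
  proof -
    let ?h = "(!) vs"
    have h: "bij_betw ?h {0..<n} (set vs)"
      using bij_betw_nth[OF vs(1), of "{0..<n}" "set vs"] vs(2) by (simp add: lessThan_atLeast0)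
    have edges: "edges G = (`) ?h ` edges (cycle_graph n)"
      using edges_cycle_of_map[of ?h "[0..<n]"] vs map_nth[of vs] by (simp add: cycle_graph_def)
    let ?f = "inv_into {0..<n} ?h"
    have f: "bij_betw ?f (set vs) {0..<n}" using h by (rule bij_betw_inv_into)
    have "{u, v} \<in> edges G \<longleftrightarrow> {?f u, ?f v} \<in> edges (cycle_graph n)" if uv: "u \<in> set vs" "v \<in> set vs" for u v
    proof -
      have img: "?h ` {?f u, ?f v} = {u, v}" and sub: "{?f u, ?f v} \<subseteq> {0..<n}"
        using uv h f by (auto simp: bij_betw_inv_into_right bij_betw_def)
      have "e = {?f u, ?f v}" if "e \<in> edges (cycle_graph n)" "?h ` e = {u, v}" for e
      proof -
        have "e \<subseteq> {0..<n}" using that(1) C by (auto simp: simple_graph_def)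
        then show ?thesis
          using that(2) img sub h by (metis bij_betw_def inj_on_image_eq_iff)
      qed
      moreover have "{u, v} \<in> edges G" if "{?f u, ?f v} \<in> edges (cycle_graph n)"
        unfolding edges using img[symmetric] that by (rule image_eqI)
      ultimately show ?thesis unfolding edges by (metis (no_types) imageE)
    qed
    then show ?thesis
      using f vs(3) unfolding isomorphic_def C(2) by auto
  qed
  ultimately show ?thesis by blast
qed

section \<open>The characterisation\<close>

theorem theorem4p5:
  fixes G :: "'a ugraph"
  assumes "simple_graph G"
  shows "(\<exists>g\<ge>9. girth G = enat g \<and> well_indumatched G \<and>
            \<not> (\<exists>H. proper_subgraph H G \<and> well_indumatched H \<and> girth H = enat g))
         \<longleftrightarrow>
         (isomorphic G (cycle_graph 11) \<or>
          (reduced G \<and> unicyclic G \<and>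
           (\<exists>vs g. distinct vs \<and> length vs = g \<and> unique_cycle G = cycle_of vs \<and>
              even g \<and> g \<ge> 10 \<and>
              (\<forall>i<g. type_i (cycle_tree G (vs ! i)) (vs ! i) \<or>
                     type_ii (cycle_tree G (vs ! i)) (vs ! i)) \<and>
              (\<forall>i<g. type_ii (cycle_tree G (vs ! i)) (vs ! i) \<noteq>
                     type_ii (cycle_tree G (vs ! (Suc i mod g))) (vs ! (Suc i mod g))))))"
    (is "?A \<longleftrightarrow> ?B \<or> ?R \<and> ?U \<and> ?T")
proof
  assume ?A
  then obtain g where g: "9 \<le> g" "girth G = enat g" "well_indumatched G"
    and minimal: "\<And>H. subgraph H G \<Longrightarrow> well_indumatched H \<Longrightarrow> girth H = enat g \<Longrightarrow> H = G"
    unfolding proper_subgraph_def by blast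
  obtain vs where vs: "distinct vs" "length vs = g" "cycle_of vs \<in> cycles G"
    using girth_cycle[OF g(2)] by metis
  interpret shortest_cycle G vs
    using assms g vs by unfold_locales auto
  show "?B \<or> ?R \<and> ?U \<and> ?T"
  proof (cases "g = 11")
    case True
    \<comment> \<open>For length 11 the shortest cycle is itself a well-indumatched subgraph of the
      same girth, so minimality makes it all of \<open>G\<close>.\<close>
    have "subgraph (cycle_of vs) G" using vs(3) by (simp add: cycles_def)
    moreover have "girth (cycle_of vs) = enat g"
      using cycles_cycle_of[OF vs(1)] card_edges_cycle_of[OF vs(1)] vs(2) True by (simp add: girth_def)
    ultimately have "cycle_of vs = G"
      using minimal well_indumatched_cycle_11[OF vs(1)] vs(2) True by blast
    then show ?thesis using isomorphic_cycle_graph_iff[OF assms, of 11] vs True by auto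
  next
    case False
    then obtain K I a b where K: "subgraph K G" "tailed_cycle K vs I a b"
      using tailed_subgraph g(3) vs(2) by blast
    then have "K = G"
      using minimal tailed_cycle.well_indumatched tailed_cycle.girth vs(2) by metis
    then interpret T: tailed_cycle G vs I a b using K by simp
    have "even g" using alternating_tails(1)[OF g(3)] False vs(2) by simp
    then have "10 \<le> g" using g(1) by (cases "g = 9") auto
    have ?T
    proof (intro exI[of _ vs] exI[of _ g] conjI allI impI)
      fix i assume i: "i < g"
      show "type_i (cycle_tree G (vs ! i)) (vs ! i) \<or> type_ii (cycle_tree G (vs ! i)) (vs ! i)"
        using T.type_ii_iff[of i] T.cycle_tree_notin[of i] i vs(2) by blast
      have "Suc i mod g < g" using i by simp
      then show "type_ii (cycle_tree G (vs ! i)) (vs ! i) \<noteq>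
          type_ii (cycle_tree G (vs ! (Suc i mod g))) (vs ! (Suc i mod g))"
        using T.type_ii_iff T.alternate[of i] i vs(2) by simp
    qed (use vs(1,2) T.unique_cycle \<open>even g\<close> \<open>10 \<le> g\<close> in auto)
    moreover have ?U using T.connected T.cycles by (auto simp: unicyclic_def)
    ultimately show ?thesis using T.reduced by blast
  qed
next
  assume "?B \<or> ?R \<and> ?U \<and> ?T"
  then show ?A
  proof
    assume ?B
    then obtain vs where vs: "distinct vs" "length vs = 11" "G = cycle_of vs"
      using isomorphic_cycle_graph_iff[OF assms, of 11] by auto
    have cycles: "cycles G = {G}" using cycles_cycle_of[OF vs(1)] vs(2,3) by simp
    then have "girth G = enat 11" using vs card_edges_cycle_of[of vs] by (simp add: girth_def)
    moreover have "H = G" if H: "subgraph H G" "girth H = enat 11" for H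
    proof -
      \<comment> \<open>A subgraph of finite girth contains a cycle, and the only cycle of
        \<open>G\<close> is \<open>G\<close> itself.\<close>
      obtain ws where "cycle_of ws \<in> cycles H" using girth_cycle[OF H(2)] by metis
      then have "subgraph G H"
        using H(1) cycles by (auto simp: cycles_def intro: subgraph_trans)
      then show ?thesis using H(1) by (auto simp: subgraph_def intro: ugraph.equality)
    qed
    ultimately show ?A
      using well_indumatched_cycle_11 vs unfolding proper_subgraph_def
      by (intro exI[of _ 11]) auto
  next
    assume R: "?R \<and> ?U \<and> ?T"
    then obtain vs where vs: "distinct vs" "unique_cycle G = cycle_of vs" "even (length vs)" "10 \<le> length vs"
      "\<And>i. i < length vs \<Longrightarrow>
        type_i (cycle_tree G (vs ! i)) (vs ! i) \<or> type_ii (cycle_tree G (vs ! i)) (vs ! i)"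
      "\<And>i. i < length vs \<Longrightarrow> type_ii (cycle_tree G (vs ! i)) (vs ! i) \<noteq>
        type_ii (cycle_tree G (vs ! (Suc i mod length vs))) (vs ! (Suc i mod length vs))"
      by blast
    then obtain I a b where "tailed_cycle G vs I a b"
      using unicyclic_tailed_cycle[OF assms _ vs(1,4,2,5,6)] R by blast
    then interpret T: tailed_cycle G vs I a b .
    have "H = G" if H: "subgraph H G" "well_indumatched H" "girth H = enat (length vs)" for H
    proof -
      obtain ws where ws: "distinct ws" "length ws = length vs" "cycle_of ws \<in> cycles H"
        using girth_cycle[OF H(3)] by metis
      interpret S: shortest_cycle H ws
        using H ws vs(4) by unfold_locales (auto simp: subgraph_def)
      \<comment> \<open>Parity excludes 11, so \<open>H\<close> contains a tailed cycle of its own,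
        perhaps with other tails; having as many edges as \<open>G\<close>, it exhausts
        \<open>H\<close>.\<close>
      have "length ws \<noteq> 11" using ws(2) vs(3) by auto
      then obtain K I' a' b' where K: "subgraph K H" "tailed_cycle K ws I' a' b'"
        using S.tailed_subgraph H(2) by blast
      have "card (edges K) = card (edges G)"
        using tailed_cycle.card_edges[OF K(2)] T.card_edges ws(2) by simp
      moreover have "edges K \<subseteq> edges H" "edges H \<subseteq> edges G" "verts H \<subseteq> verts G" "simple_graph H"
        using K(1) H(1) by (auto simp: subgraph_def)
      ultimately have E: "edges H = edges G"
        using finite_edges[OF assms] by (metis card_subset_eq order_trans subset_antisym)
      have "verts G \<subseteq> verts H"
        using T.verts_subset_Union_edges \<open>simple_graph H\<close> unfolding E[symmetric] simple_graph_def by blast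
      with E \<open>verts H \<subseteq> verts G\<close> show ?thesis by (auto intro: ugraph.equality)
    qed
    then show ?A
      using T.girth T.well_indumatched vs(4) unfolding proper_subgraph_def
      by (intro exI[of _ "length vs"]) auto
  qed
qed

end
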